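(* Let $A$ be a periodic (i.e. torsion) abelian group. Then every (finite or infinite) unimodular system of equations over $A$ is solvable in $A$ itself if and only if the reduced part of $A$ has bounded period.
   Context: Equations over groups. Let $G$ be a group and let $X=\{x_j\}_{j\in J}$ be a (possibly infinite) set of variables. Let $F(X)$ be the free group with basis $X$ and $G*F(X)$ the free product. An equation over $G$ is an expression $w=1$ with $w\in G*F(X)$ (each $w$ involves only finitely many variables). A system of equations over $G$ is a (finite or infinite) family $\{w_i=1\}_{i\in I}$ of such equations. The system is solvable in $G$ itself if there are elements $g_j\in G$ $(j\in J)$ such that substituting $g_j$ for $x_j$ makes all $w_i$ equal to $1$ in $G$; equivalently, there is a homomorphism $G*F(X)\to G$ which is the identity on $G$ and sends every $w_i$ to $1$. Exponent sums. For a system $\{w_i=1\}_{i\in I}$ let $a_{ij}\in\mathbb Z$ be the exponent sum of $x_j$ in $w_i$ (for example, the exponent sum of $x$ in $x^{-1}gyx^2g^2x^{-3}y^2$ is $-2$). The row of the $i$-th equation is $(a_{ij})_{j\in J}$; it has finitely many non-zero entries. For a prime $p$, the system is $p$-nonsingular if the family of rows reduced modulo $p$, indexed by $i\in I$, is linearly independent over the field $\mathbb Z_p$ of order $p$ (equivalently, this holds for every finite subsystem). The system is unimodular if it is $p$-nonsingular for every prime $p$. Abelian groups. The period of a group is its exponent; a group $G$ has bounded period if there is an integer $n\ge 1$ with $g^n=1$ for all $g\in G$. An abelian group is divisible if each of its elements is an $n$-th multiple of some element for every integer $n\ge1$, and reduced if it has no non-zero divisible subgroup. The reduced part of an abelian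 group $A$ is any group $C$ such that $A=C\oplus D$ with $D$ divisible and $C$ reduced; such a decomposition always exists and $C\cong A/D$, where $D$ is the largest divisible subgroup of $A$, so $C$ is unique up to isomorphism. *)

theory Defs
  imports "HOL-Algebra.Coset" "HOL-Number_Theory.Residues"
begin

text \<open>
  The group \<open>G * F(X)\<close> is built as the set of words in the letters \<open>g \<in> G\<close> and \<open>x\<close>, \<open>x\<inverse>\<close>
  for \<open>x \<in> X\<close>, modulo the congruence generated by the multiplication table of \<open>G\<close> and by the
  cancellation of \<open>x\<close> against \<open>x\<inverse>\<close>. The letter \<open>Var x True\<close> stands for \<open>x\<close>, and
  \<open>Var x False\<close> for \<open>x\<inverse>\<close>.
\<close>

datatype ('a, 'x) letter = Const 'a | Var 'x bool

definition letters :: "('a, 'm) monoid_scheme \<Rightarrow> 'x set \<Rightarrow> ('a, 'x) letter set" where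
  "letters G X = Const ` carrier G \<union> {Var x e | x e. x \<in> X}"

definition words :: "('a, 'm) monoid_scheme \<Rightarrow> 'x set \<Rightarrow> ('a, 'x) letter list set" where
  "words G X = lists (letters G X)"

inductive word_cong ::
    "('a, 'm) monoid_scheme \<Rightarrow> 'x set \<Rightarrow> ('a, 'x) letter list \<Rightarrow> ('a, 'x) letter list \<Rightarrow> bool"
  for G X where
  refl: "u \<in> words G X \<Longrightarrow> word_cong G X u u"
| sym: "word_cong G X u v \<Longrightarrow> word_cong G X v u"
| trans: "word_cong G X u v \<Longrightarrow> word_cong G X v w \<Longrightarrow> word_cong G X u w"
| append: "word_cong G X u u' \<Longrightarrow> word_cong G X v v' \<Longrightarrow> word_cong G X (u @ v) (u' @ v')"
| const_one: "word_cong G X [Const \<one>\<^bsub>G\<^esub>] []"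
| const_mult: "g \<in> carrier G \<Longrightarrow> h \<in> carrier G \<Longrightarrow>
    word_cong G X [Const g, Const h] [Const (g \<otimes>\<^bsub>G\<^esub> h)]"
| cancel: "x \<in> X \<Longrightarrow> word_cong G X [Var x e, Var x (\<not> e)] []"

definition word_class ::
    "('a, 'm) monoid_scheme \<Rightarrow> 'x set \<Rightarrow> ('a, 'x) letter list \<Rightarrow> ('a, 'x) letter list set" where
  "word_class G X u = {v. word_cong G X u v}"

definition free_product :: "('a, 'm) monoid_scheme \<Rightarrow> 'x set \<Rightarrow> ('a, 'x) letter list set monoid" where
  "free_product G X =
    \<lparr>carrier = word_class G X ` words G X,
     monoid.mult = (\<lambda>a b. {w. \<exists>u\<in>a. \<exists>v\<in>b. word_cong G X (u @ v) w}),
     one = word_class G X []\<rparr>"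

definition fp_const :: "('a, 'm) monoid_scheme \<Rightarrow> 'x set \<Rightarrow> 'a \<Rightarrow> ('a, 'x) letter list set" where
  "fp_const G X g = word_class G X [Const g]"

definition fp_var :: "('a, 'm) monoid_scheme \<Rightarrow> 'x set \<Rightarrow> 'x \<Rightarrow> ('a, 'x) letter list set" where
  "fp_var G X x = word_class G X [Var x True]"

lemma word_cong_words:
  assumes "group G" and "word_cong G X u v"
  shows "u \<in> words G X \<and> v \<in> words G X"
proof -
  interpret group G by fact
  show ?thesis
    using assms(2) by induction (auto simp: words_def letters_def)
qed

lemma word_class_eq_iff:
  assumes "v \<in> words G X"
  shows "word_class G X u = word_class G X v \<longleftrightarrow> word_cong G X u v"
  using assms unfolding word_class_def
  by (blast intro: word_cong.refl word_cong.sym word_cong.trans)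

lemma free_product_carrier: "carrier (free_product G X) = word_class G X ` words G X"
  by (simp add: free_product_def)

lemma free_product_one: "\<one>\<^bsub>free_product G X\<^esub> = word_class G X []"
  by (simp add: free_product_def)

lemma free_product_mult:
  assumes "u \<in> words G X" "v \<in> words G X"
  shows "word_class G X u \<otimes>\<^bsub>free_product G X\<^esub> word_class G X v = word_class G X (u @ v)"
proof -
  have "word_cong G X (u @ v) w"
    if "word_cong G X u u'" "word_cong G X v v'" "word_cong G X (u' @ v') w" for u' v' w
    using that by (blast intro: word_cong.append word_cong.trans)
  then show ?thesis
    using assms by (auto simp: free_product_def word_class_def intro: word_cong.refl)
qed

primrec letter_inverse :: "('a, 'm) monoid_scheme \<Rightarrow> ('a, 'x) letter \<Rightarrow> ('a, 'x) letter" where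
  "letter_inverse G (Const g) = Const (inv\<^bsub>G\<^esub> g)"
| "letter_inverse G (Var x e) = Var x (\<not> e)"

lemma group_free_product:
  assumes "group G"
  shows "group (free_product G X)"
proof -
  interpret group G by fact
  have app: "u @ v \<in> words G X \<longleftrightarrow> u \<in> words G X \<and> v \<in> words G X" for u v :: "('a, 'c) letter list"
    by (auto simp: words_def)
  have nil: "[] \<in> words G X" by (simp add: words_def)
  have linv: "\<exists>v\<in>words G X. word_cong G X (v @ u) []" if "u \<in> words G X" for u
    using that
  proof (induction u)
    case Nil
    then show ?case using nil by (auto intro: word_cong.refl)
  next
    case (Cons l u)
    then have l: "l \<in> letters G X" and u: "u \<in> words G X"
      by (auto simp: words_def)
    then obtain v where v: "v \<in> words G X" "word_cong G X (v @ u) []"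
      using Cons.IH by blast
    have li: "letter_inverse G l \<in> letters G X"
      using l by (auto simp: letters_def)
    have "word_cong G X [letter_inverse G l, l] []"
    proof (cases l)
      case (Const g)
      then have "g \<in> carrier G" using l by (auto simp: letters_def)
      then show ?thesis
        using Const word_cong.const_mult[of "inv\<^bsub>G\<^esub> g" G g X] word_cong.const_one
        by (auto intro: word_cong.trans)
    next
      case (Var x e)
      then have "x \<in> X" using l by (auto simp: letters_def)
      then show ?thesis
        using Var word_cong.cancel[of x X G "\<not> e"] by simp
    qed
    then have "word_cong G X (v @ ([letter_inverse G l, l] @ u)) (v @ ([] @ u))"
      using u v by (intro word_cong.append word_cong.refl) auto
    then have "word_cong G X ((v @ [letter_inverse G l]) @ (l # u)) []"
      using v by (auto intro: word_cong.trans)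
    moreover have "v @ [letter_inverse G l] \<in> words G X"
      using v li by (auto simp: words_def)
    ultimately show ?case by blast
  qed
  show ?thesis
  proof (rule groupI)
    fix a assume "a \<in> carrier (free_product G X)"
    then obtain u where u: "u \<in> words G X" "a = word_class G X u"
      by (auto simp: free_product_carrier)
    then obtain v where "v \<in> words G X" "word_cong G X (v @ u) []"
      using linv by blast
    then have "word_class G X v \<otimes>\<^bsub>free_product G X\<^esub> a = \<one>\<^bsub>free_product G X\<^esub>"
      using u nil by (simp add: free_product_mult free_product_one word_class_eq_iff)
    then show "\<exists>b\<in>carrier (free_product G X).
        b \<otimes>\<^bsub>free_product G X\<^esub> a = \<one>\<^bsub>free_product G X\<^esub>"
      using \<open>v \<in> words G X\<close> by (auto simp: free_product_carrier)
  qed (use nil app in \<open>auto simp: free_product_carrier free_product_one free_product_mult\<close>)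
qed

primrec letter_value ::
    "('b, 'n) monoid_scheme \<Rightarrow> ('a \<Rightarrow> 'b) \<Rightarrow> ('x \<Rightarrow> 'b) \<Rightarrow> ('a, 'x) letter \<Rightarrow> 'b" where
  "letter_value H \<phi> f (Const g) = \<phi> g"
| "letter_value H \<phi> f (Var x e) = (if e then f x else inv\<^bsub>H\<^esub> f x)"

primrec word_value ::
    "('b, 'n) monoid_scheme \<Rightarrow> ('a \<Rightarrow> 'b) \<Rightarrow> ('x \<Rightarrow> 'b) \<Rightarrow> ('a, 'x) letter list \<Rightarrow> 'b" where
  "word_value H \<phi> f [] = \<one>\<^bsub>H\<^esub>"
| "word_value H \<phi> f (l # u) = letter_value H \<phi> f l \<otimes>\<^bsub>H\<^esub> word_value H \<phi> f u"

context
  fixes G :: "('a, 'm) monoid_scheme" and H :: "('b, 'n) monoid_scheme"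
    and X :: "'x set" and \<phi> :: "'a \<Rightarrow> 'b" and f :: "'x \<Rightarrow> 'b"
  assumes G: "group G" and H: "group H"
    and \<phi>: "\<phi> \<in> hom G H" and f: "f \<in> X \<rightarrow> carrier H"
begin

interpretation G: group G by (rule G)
interpretation H: group H by (rule H)
interpretation \<phi>: group_hom G H \<phi>
  using G H \<phi> by (simp add: group_hom_def group_hom_axioms_def)

lemma letter_value_closed: "l \<in> letters G X \<Longrightarrow> letter_value H \<phi> f l \<in> carrier H"
  using f by (fastforce simp: letters_def Pi_iff)

lemma word_value_closed: "u \<in> words G X \<Longrightarrow> word_value H \<phi> f u \<in> carrier H"
  by (induction u) (auto simp: words_def letter_value_closed)

lemma word_value_append:
  "u \<in> words G X \<Longrightarrow> v \<in> words G X \<Longrightarrow>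
    word_value H \<phi> f (u @ v) = word_value H \<phi> f u \<otimes>\<^bsub>H\<^esub> word_value H \<phi> f v"
proof (induction u)
  case Nil
  then show ?case using word_value_closed by simp
next
  case (Cons l u)
  then have "l \<in> letters G X" "u \<in> words G X" by (auto simp: words_def)
  with Cons show ?case
    using word_value_closed by (simp add: H.m_assoc letter_value_closed)
qed

lemma word_value_cong:
  "word_cong G X u v \<Longrightarrow> word_value H \<phi> f u = word_value H \<phi> f v"
proof (induction rule: word_cong.induct)
  case (append u u' v v')
  moreover have "u \<in> words G X" "u' \<in> words G X" "v \<in> words G X" "v' \<in> words G X"
    using append.hyps word_cong_words[OF G] by auto
  ultimately show ?case by (simp add: word_value_append)
next
  case (cancel x e)
  then have "f x \<in> carrier H" using f by auto
  then show ?case by simp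
qed auto

lemma free_product_extend_hom:
  "\<exists>h \<in> hom (free_product G X) H.
    (\<forall>g\<in>carrier G. h (fp_const G X g) = \<phi> g) \<and>
    (\<forall>x\<in>X. h (fp_var G X x) = f x) \<and>
    (\<forall>u\<in>words G X. h (word_class G X u) = word_value H \<phi> f u)"
proof -
  define h where "h c = the_elem (word_value H \<phi> f ` c)" for c
  have h: "h (word_class G X u) = word_value H \<phi> f u" if "u \<in> words G X" for u
  proof -
    have "word_value H \<phi> f ` word_class G X u = {word_value H \<phi> f u}"
    proof (rule subset_antisym)
      show "word_value H \<phi> f ` word_class G X u \<subseteq> {word_value H \<phi> f u}"
        using word_value_cong[symmetric] by (auto simp only: word_class_def)
      show "{word_value H \<phi> f u} \<subseteq> word_value H \<phi> f ` word_class G X u"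
        using word_cong.refl[OF that] by (simp add: word_class_def)
    qed
    then show ?thesis by (simp add: h_def)
  qed
  have app: "u @ v \<in> words G X" if "u \<in> words G X" "v \<in> words G X" for u v
    using that by (auto simp: words_def)
  have "h \<in> hom (free_product G X) H"
    by (rule homI)
      (auto simp: free_product_carrier free_product_mult h app word_value_closed word_value_append)
  moreover have "h (fp_const G X g) = \<phi> g" if "g \<in> carrier G" for g
  proof -
    have "[Const g] \<in> words G X" using that by (auto simp: words_def letters_def)
    then show ?thesis using that h by (simp add: fp_const_def)
  qed
  moreover have "h (fp_var G X x) = f x" if "x \<in> X" for x
  proof -
    have "[Var x True] \<in> words G X" using that by (auto simp: words_def letters_def)
    moreover have "f x \<in> carrier H" using that f by auto
    ultimately show ?thesis using h by (simp add: fp_var_def)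
  qed
  ultimately show ?thesis using h by blast
qed

end

primrec letter_exponent :: "'x \<Rightarrow> ('a, 'x) letter \<Rightarrow> int" where
  "letter_exponent y (Const g) = 0"
| "letter_exponent y (Var x e) = (if x = y then if e then 1 else -1 else 0)"

definition word_exponent_sum :: "'x \<Rightarrow> ('a, 'x) letter list \<Rightarrow> int" where
  "word_exponent_sum y u = (\<Sum>l\<leftarrow>u. letter_exponent y l)"

text \<open>
  All words in a class have the same exponent sum (lemma \<open>exponent_sum_word_class\<close> below), so
  that \<^const>\<open>the_elem\<close> is applied to a singleton.
\<close>

definition exponent_sum :: "'x \<Rightarrow> ('a, 'x) letter list set \<Rightarrow> int" where
  "exponent_sum y c = the_elem (word_exponent_sum y ` c)"

lemma exponent_sum_word_class:
  assumes "u \<in> words G X"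
  shows "exponent_sum y (word_class G X u) = word_exponent_sum y u"
proof -
  have *: "word_exponent_sum y v = word_exponent_sum y v'" if "word_cong G X v v'" for v v'
    using that by induction (simp_all add: word_exponent_sum_def)
  then have "word_exponent_sum y ` word_class G X u = {word_exponent_sum y u}"
  proof (intro subset_antisym)
    show "word_exponent_sum y ` word_class G X u \<subseteq> {word_exponent_sum y u}"
      using *[symmetric] by (auto simp only: word_class_def)
    show "{word_exponent_sum y u} \<subseteq> word_exponent_sum y ` word_class G X u"
      using word_cong.refl[OF assms] by (simp add: word_class_def)
  qed
  then show ?thesis by (simp add: exponent_sum_def)
qed

text \<open>
  A system consists of an index set \<open>I\<close>, a set of variables \<open>J\<close> and a family \<open>w\<close>; only the
  values of \<open>w\<close> on \<open>I\<close> matter. Since \<open>I\<close> and \<open>J\<close> are arbitrary subsets of their types, each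
  type merely bounds the cardinality of the systems, and any infinite types accommodate all
  finite and countable ones.
\<close>

definition equation_system ::
    "('a, 'm) monoid_scheme \<Rightarrow> 'i set \<Rightarrow> 'j set \<Rightarrow> ('i \<Rightarrow> ('a, 'j) letter list set) \<Rightarrow> bool" where
  "equation_system G I J w \<longleftrightarrow> (\<forall>i\<in>I. w i \<in> carrier (free_product G J))"

definition solvable_in_itself ::
    "('a, 'm) monoid_scheme \<Rightarrow> 'i set \<Rightarrow> 'j set \<Rightarrow> ('i \<Rightarrow> ('a, 'j) letter list set) \<Rightarrow> bool" where
  "solvable_in_itself G I J w \<longleftrightarrow>
    (\<exists>h \<in> hom (free_product G J) G.
      (\<forall>g\<in>carrier G. h (fp_const G J g) = g) \<and> (\<forall>i\<in>I. h (w i) = \<one>\<^bsub>G\<^esub>))"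

lemma solvable_in_itself_iff_substitution:
  assumes "group G" and "\<And>i. i \<in> I \<Longrightarrow> u i \<in> words G J"
  shows "solvable_in_itself G I J (\<lambda>i. word_class G J (u i)) \<longleftrightarrow>
    (\<exists>s \<in> J \<rightarrow> carrier G. \<forall>i\<in>I. word_value G (\<lambda>g. g) s (u i) = \<one>\<^bsub>G\<^esub>)"
proof -
  interpret group G by fact
  interpret F: group "free_product G J" using assms(1) by (rule group_free_product)
  have id: "(\<lambda>g. g) \<in> hom G G" by (simp add: hom_def)
  show ?thesis
  proof
    assume "solvable_in_itself G I J (\<lambda>i. word_class G J (u i))"
    then obtain h where h: "h \<in> hom (free_product G J) G"
      "\<And>g. g \<in> carrier G \<Longrightarrow> h (fp_const G J g) = g"
      "\<And>i. i \<in> I \<Longrightarrow> h (word_class G J (u i)) = \<one>\<^bsub>G\<^esub>"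
      by (auto simp: solvable_in_itself_def)
    interpret h: group_hom "free_product G J" G h
      by unfold_locales (rule h(1))
    define s where "s x = h (fp_var G J x)" for x
    have var: "[Var x e] \<in> words G J" if "x \<in> J" for x e
      using that by (auto simp: words_def letters_def)
    have s: "s \<in> J \<rightarrow> carrier G"
      using var[of _ True] by (auto simp: s_def fp_var_def free_product_carrier intro!: h.hom_closed)
    have letter: "h (word_class G J [l]) = letter_value G (\<lambda>g. g) s l" if "l \<in> letters G J" for l
    proof (cases l)
      case (Const g)
      then show ?thesis using that h(2) by (auto simp: letters_def fp_const_def)
    next
      case (Var x e)
      then have x: "x \<in> J" using that by (auto simp: letters_def)
      have "word_class G J [Var x False] \<otimes>\<^bsub>free_product G J\<^esub> fp_var G J x = \<one>\<^bsub>free_product G J\<^esub>"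
        using x var word_cong.cancel[of x J G False]
        by (simp add: fp_var_def free_product_mult free_product_one word_class_eq_iff words_def)
      then have "word_class G J [Var x False] = inv\<^bsub>free_product G J\<^esub> fp_var G J x"
        using x var by (intro F.inv_equality[symmetric]) (auto simp: fp_var_def free_product_carrier)
      moreover have "fp_var G J x \<in> carrier (free_product G J)"
        using x var by (auto simp: fp_var_def free_product_carrier)
      ultimately show ?thesis
        using Var by (simp add: s_def fp_var_def)
    qed
    have word: "h (word_class G J v) = word_value G (\<lambda>g. g) s v" if "v \<in> words G J" for v
      using that
    proof (induction v)
      case Nil
      then show ?case by (simp add: free_product_one[symmetric])
    next
      case (Cons l v)
      then have l: "l \<in> letters G J" and v: "v \<in> words G J" "[l] \<in> words G J"
        by (auto simp: words_def)
      have "word_class G J (l # v) = word_class G J [l] \<otimes>\<^bsub>free_product G J\<^esub> word_class G J v"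
        using v by (simp add: free_product_mult)
      then have "h (word_class G J (l # v)) = h (word_class G J [l]) \<otimes>\<^bsub>G\<^esub> h (word_class G J v)"
        using v by (simp add: free_product_carrier)
      then show ?case using Cons.IH v letter[OF l] by simp
    qed
    show "\<exists>s \<in> J \<rightarrow> carrier G. \<forall>i\<in>I. word_value G (\<lambda>g. g) s (u i) = \<one>\<^bsub>G\<^esub>"
      using s h(3) word assms(2) by (intro bexI[of _ s]) auto
  next
    assume "\<exists>s \<in> J \<rightarrow> carrier G. \<forall>i\<in>I. word_value G (\<lambda>g. g) s (u i) = \<one>\<^bsub>G\<^esub>"
    then obtain s where s: "s \<in> J \<rightarrow> carrier G" "\<And>i. i \<in> I \<Longrightarrow> word_value G (\<lambda>g. g) s (u i) = \<one>\<^bsub>G\<^esub>"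
      by blast
    obtain h where "h \<in> hom (free_product G J) G" "\<forall>g\<in>carrier G. h (fp_const G J g) = g"
      "\<And>v. v \<in> words G J \<Longrightarrow> h (word_class G J v) = word_value G (\<lambda>g. g) s v"
      using free_product_extend_hom[OF assms(1) assms(1) id s(1)] by blast
    then show "solvable_in_itself G I J (\<lambda>i. word_class G J (u i))"
      unfolding solvable_in_itself_def using s(2) assms(2) by (intro bexI[of _ h]) auto
  qed
qed

definition lin_indep_family ::
    "('f, 'm) ring_scheme \<Rightarrow> 'i set \<Rightarrow> 'j set \<Rightarrow> ('i \<Rightarrow> 'j \<Rightarrow> 'f) \<Rightarrow> bool" where
  "lin_indep_family K I J v \<longleftrightarrow>
    (\<forall>S c. finite S \<and> S \<subseteq> I \<and> c \<in> S \<rightarrow> carrier K \<and>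
        (\<forall>j\<in>J. (\<Oplus>\<^bsub>K\<^esub>i\<in>S. c i \<otimes>\<^bsub>K\<^esub> v i j) = \<zero>\<^bsub>K\<^esub>)
      \<longrightarrow> (\<forall>i\<in>S. c i = \<zero>\<^bsub>K\<^esub>))"

definition p_nonsingular ::
    "nat \<Rightarrow> 'i set \<Rightarrow> 'j set \<Rightarrow> ('i \<Rightarrow> ('a, 'j) letter list set) \<Rightarrow> bool" where
  "p_nonsingular p I J w \<longleftrightarrow>
    lin_indep_family (residue_ring (int p)) I J (\<lambda>i j. exponent_sum j (w i) mod int p)"

definition unimodular ::
    "'i set \<Rightarrow> 'j set \<Rightarrow> ('i \<Rightarrow> ('a, 'j) letter list set) \<Rightarrow> bool" where
  "unimodular I J w \<longleftrightarrow> (\<forall>p. Factorial_Ring.prime p \<longrightarrow> p_nonsingular p I J w)"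

definition periodic_group :: "('a, 'm) monoid_scheme \<Rightarrow> bool" where
  "periodic_group G \<longleftrightarrow> (\<forall>g\<in>carrier G. \<exists>n::nat. n \<ge> 1 \<and> g [^]\<^bsub>G\<^esub> n = \<one>\<^bsub>G\<^esub>)"

definition bounded_period :: "('a, 'm) monoid_scheme \<Rightarrow> bool" where
  "bounded_period G \<longleftrightarrow> (\<exists>n::nat. n \<ge> 1 \<and> (\<forall>g\<in>carrier G. g [^]\<^bsub>G\<^esub> n = \<one>\<^bsub>G\<^esub>))"

definition divisible_group :: "('a, 'm) monoid_scheme \<Rightarrow> bool" where
  "divisible_group G \<longleftrightarrow>
    (\<forall>n::nat. n \<ge> 1 \<longrightarrow> (\<forall>g\<in>carrier G. \<exists>h\<in>carrier G. h [^]\<^bsub>G\<^esub> n = g))"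

definition reduced_group :: "('a, 'm) monoid_scheme \<Rightarrow> bool" where
  "reduced_group G \<longleftrightarrow>
    (\<forall>H. subgroup H G \<and> divisible_group (G\<lparr>carrier := H\<rparr>) \<longrightarrow> H = {\<one>\<^bsub>G\<^esub>})"

text \<open>
  The summands are taken as internal ones; every external decomposition is isomorphic to such a
  one. By \<open>ex_reduced_part\<close> below, a reduced part exists in every abelian group.
\<close>

definition is_reduced_part :: "('a, 'm) monoid_scheme \<Rightarrow> 'a set \<Rightarrow> bool" where
  "is_reduced_part A C \<longleftrightarrow>
    subgroup C A \<and> reduced_group (A\<lparr>carrier := C\<rparr>) \<and>
    (\<exists>D. subgroup D A \<and> divisible_group (A\<lparr>carrier := D\<rparr>) \<and>
      C \<inter> D = {\<one>\<^bsub>A\<^esub>} \<and> C <#>\<^bsub>A\<^esub> D = carrier A)"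

lemma (in comm_group) ex_reduced_part: "\<exists>C. is_reduced_part G C"
proof -
  define divisible where
    "divisible H \<longleftrightarrow> subgroup H G \<and> divisible_group (G\<lparr>carrier := H\<rparr>)" for H
  have divisible_iff: "divisible H \<longleftrightarrow>
      subgroup H G \<and> (\<forall>n::nat. n \<ge> 1 \<longrightarrow> (\<forall>g\<in>H. \<exists>h\<in>H. h [^] n = g))" for H
    by (simp add: divisible_def divisible_group_def flip: nat_pow_consistent)
  have divisible_mult: "divisible (H <#> K)" if HK: "divisible H" "divisible K" for H K
    unfolding divisible_iff
  proof (intro conjI allI impI ballI)
    show "subgroup (H <#> K) G"
      using that by (auto simp: divisible_def intro: mult_subgroups)
    fix n :: nat and g assume n: "n \<ge> 1" and "g \<in> H <#> K"
    then obtain x y where xy: "x \<in> H" "y \<in> K" "g = x \<otimes> y"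
      by (auto simp: set_mult_def)
    obtain x' y' where x'y': "x' \<in> H" "x' [^] n = x" "y' \<in> K" "y' [^] n = y"
      using HK n xy unfolding divisible_iff by meson
    have "x' \<in> carrier G" "y' \<in> carrier G"
      using that x'y' by (auto simp: divisible_def dest: subgroup.mem_carrier)
    then have "(x' \<otimes> y') [^] n = g"
      using x'y' xy by (simp add: nat_pow_distrib)
    then show "\<exists>h\<in>H <#> K. h [^] n = g"
      using x'y' by (intro bexI[of _ "x' \<otimes> y'"]) (auto simp: set_mult_def)
  qed
  have subset_mult: "H \<subseteq> H <#> K" "K \<subseteq> H <#> K" if "subgroup H G" "subgroup K G" for H K
  proof -
    interpret H: subgroup H G by fact
    interpret K: subgroup K G by fact
    show "H \<subseteq> H <#> K"
    proof
      fix x assume "x \<in> H"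
      then have "x = x \<otimes> \<one>" by simp
      then show "x \<in> H <#> K" using \<open>x \<in> H\<close> K.one_closed unfolding set_mult_def by blast
    qed
    show "K \<subseteq> H <#> K"
    proof
      fix x assume "x \<in> K"
      then have "x = \<one> \<otimes> x" by simp
      then show "x \<in> H <#> K" using \<open>x \<in> K\<close> H.one_closed unfolding set_mult_def by blast
    qed
  qed

  define D where "D = \<Union>{H. divisible H}"
  have D_upper: "H \<subseteq> D" if "divisible H" for H
    using that by (auto simp: D_def)
  have triv: "divisible {\<one>}"
    by (auto simp: divisible_iff triv_subgroup)
  have D_sub: "subgroup D G"
  proof (rule subgroupI)
    show "D \<subseteq> carrier G"
      by (auto simp: D_def divisible_def dest: subgroup.mem_carrier)
    show "D \<noteq> {}" using D_upper[OF triv] by auto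
    show "inv x \<in> D" if "x \<in> D" for x
      using that by (auto simp: D_def divisible_def intro: subgroup.m_inv_closed)
    show "x \<otimes> y \<in> D" if xy: "x \<in> D" "y \<in> D" for x y
    proof -
      obtain H K where HK: "x \<in> H" "divisible H" "y \<in> K" "divisible K"
        using xy by (auto simp: D_def)
      then have "x \<otimes> y \<in> H <#> K" by (auto simp: set_mult_def)
      then show ?thesis using D_upper[OF divisible_mult[OF HK(2,4)]] by auto
    qed
  qed
  have "\<exists>h\<in>D. h [^] n = g" if ng: "n \<ge> 1" "g \<in> D" for n :: nat and g
  proof -
    obtain H where H: "g \<in> H" "divisible H"
      using ng by (auto simp: D_def)
    then obtain h where "h \<in> H" "h [^] n = g"
      using ng unfolding divisible_iff by blast
    then show ?thesis using D_upper[OF H(2)] by auto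
  qed
  with D_sub have D: "divisible D"
    by (auto simp: divisible_iff)
  interpret D: subgroup D G by (rule D_sub)

  define \<C> where "\<C> = {H. subgroup H G \<and> H \<inter> D = {\<one>}}"
  have "\<exists>C\<in>\<C>. \<forall>H\<in>\<C>. C \<subseteq> H \<longrightarrow> H = C"
  proof (rule subset_Zorn_nonempty)
    show "\<C> \<noteq> {}" using triv_subgroup D.one_closed by (auto simp: \<C>_def)
    fix \<K> assume \<K>: "\<K> \<noteq> {}" "subset.chain \<C> \<K>"
    then have sub: "subgroup H G" "H \<inter> D = {\<one>}" if "H \<in> \<K>" for H
      using that by (auto simp: subset.chain_def \<C>_def)
    have "subgroup (\<Union>\<K>) G"
    proof (rule subgroupI)
      show "\<Union>\<K> \<subseteq> carrier G"
        using subgroup.subset[OF sub(1)] by auto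
      show "\<Union>\<K> \<noteq> {}"
        using \<K>(1) subgroup.one_closed[OF sub(1)] by auto
      show "inv x \<in> \<Union>\<K>" if "x \<in> \<Union>\<K>" for x
        using that subgroup.m_inv_closed[OF sub(1)] by auto
      show "x \<otimes> y \<in> \<Union>\<K>" if xy: "x \<in> \<Union>\<K>" "y \<in> \<Union>\<K>" for x y
      proof -
        obtain H K where HK: "x \<in> H" "H \<in> \<K>" "y \<in> K" "K \<in> \<K>"
          using xy by auto
        then have "H \<subseteq> K \<or> K \<subseteq> H"
          using \<K>(2) by (auto simp: subset_chain_def)
        then obtain L where "L \<in> \<K>" "x \<in> L" "y \<in> L" using HK by blast
        then show ?thesis using subgroup.m_closed[OF sub(1)] by auto
      qed
    qed
    moreover have "\<Union>\<K> \<inter> D = {\<one>}"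
    proof
      show "\<Union>\<K> \<inter> D \<subseteq> {\<one>}"
        using sub(2) by auto
      obtain H where "H \<in> \<K>" using \<K>(1) by auto
      then show "{\<one>} \<subseteq> \<Union>\<K> \<inter> D"
        using sub(2)[of H] by auto
    qed
    ultimately show "\<Union>\<K> \<in> \<C>" by (simp add: \<C>_def)
  qed
  then obtain C where C_sub: "subgroup C G" and CD: "C \<inter> D = {\<one>}"
    and C_max: "\<And>H. subgroup H G \<Longrightarrow> H \<inter> D = {\<one>} \<Longrightarrow> C \<subseteq> H \<Longrightarrow> H = C"
    by (auto simp: \<C>_def)
  interpret C: subgroup C G by (rule C_sub)

  have E_sub: "subgroup (C <#> D) G"
    by (rule mult_subgroups[OF C_sub D_sub])
  interpret E: subgroup "C <#> D" G by (rule E_sub)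
  note CE = subset_mult(1)[OF C_sub D_sub] and DE = subset_mult(2)[OF C_sub D_sub]

  have adjoin: "\<exists>k::int. x [^] k \<in> C <#> D \<and> x [^] k \<notin> C"
    if x: "x \<in> carrier G" "x \<notin> C" for x
  proof (rule ccontr)
    assume no: "\<not> ?thesis"
    have x_sub: "subgroup (generate G {x}) G"
      using x(1) by (intro generate_is_subgroup) auto
    have "y = \<one>" if y: "y \<in> C <#> generate G {x}" "y \<in> D" for y
    proof -
      obtain c k where ck: "c \<in> C" "y = c \<otimes> x [^] (k::int)"
        using y(1) generate_pow[OF x(1)] by (auto simp: set_mult_def)
      then have "x [^] k = inv c \<otimes> y"
        using x(1) by (simp add: m_assoc[symmetric])
      moreover have "inv c \<otimes> y \<in> C <#> D"
        using ck y(2) C.m_inv_closed by (auto simp: set_mult_def)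
      ultimately have "x [^] k \<in> C" using no by metis
      then have "y \<in> C" using ck by simp
      then show ?thesis using y(2) CD by auto
    qed
    then have "(C <#> generate G {x}) \<inter> D = {\<one>}"
      using subset_mult(1)[OF C_sub x_sub] C.one_closed D.one_closed by blast
    then have "C <#> generate G {x} = C"
      using C_max mult_subgroups[OF C_sub x_sub] subset_mult(1)[OF C_sub x_sub] by blast
    moreover have "x \<in> generate G {x}" by (auto intro: generate.incl)
    ultimately show False
      using x(2) subset_mult(2)[OF C_sub x_sub] by blast
  qed

  have "carrier G \<subseteq> C <#> D"
  proof
    fix a assume a: "a \<in> carrier G"
    show "a \<in> C <#> D"
    proof (rule ccontr)
      assume aE: "a \<notin> C <#> D"
      then have "a \<notin> C" using CE by auto
      then obtain k :: int where k: "a [^] k \<in> C <#> D" "a [^] k \<notin> C"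
        using adjoin a by blast
      have "k \<noteq> 0"
      proof
        assume "k = 0"
        then show False using k(2) by simp
      qed
      have "a [^] \<bar>k\<bar> \<in> C <#> D"
        using k(1) E.m_inv_closed[OF k(1)] a by (cases "k \<ge> 0") (auto simp: int_pow_neg)
      then have "a [^] nat \<bar>k\<bar> \<in> C <#> D"
        by (simp flip: int_pow_int)
      then have ex: "\<exists>n::nat. n \<ge> 1 \<and> a [^] n \<in> C <#> D"
        using \<open>k \<noteq> 0\<close> by (intro exI[of _ "nat \<bar>k\<bar>"]) auto
      define n :: nat where "n = (LEAST n. n \<ge> 1 \<and> a [^] n \<in> C <#> D)"
      have n: "n \<ge> 1" "a [^] n \<in> C <#> D"
        using LeastI_ex[OF ex] by (auto simp: n_def)
      have n_dvd: "int n dvd m" if m: "a [^] m \<in> C <#> D" for m :: int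
      proof (rule ccontr)
        assume nd: "\<not> int n dvd m"
        define r where "r = nat (m mod int n)"
        have "0 \<le> m mod int n" "m mod int n < int n" "m mod int n \<noteq> 0"
          using n(1) nd by (auto simp: dvd_eq_mod_eq_0)
        then have r: "int r = m mod int n" "r < n" "r \<ge> 1"
          unfolding r_def by linarith+
        have "a [^] (int n * (m div int n)) \<in> C <#> D"
          using subgroup_int_pow_closed[OF E_sub n(2), of "m div int n"] a
          by (simp add: int_pow_pow flip: int_pow_int)
        then have "a [^] m \<otimes> inv (a [^] (int n * (m div int n))) \<in> C <#> D"
          using m by blast
        moreover have "a [^] m \<otimes> inv (a [^] (int n * (m div int n))) = a [^] int r"
          using a by (simp add: r(1) minus_mult_div_eq_mod flip: int_pow_diff)
        ultimately have "a [^] r \<in> C <#> D"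
          by (simp add: int_pow_int)
        then have "n \<le> r"
          unfolding n_def using r(3) by (intro Least_le) auto
        with r(2) show False by simp
      qed
      obtain c d where cd: "c \<in> C" "d \<in> D" "a [^] n = c \<otimes> d"
        using n(2) by (auto simp: set_mult_def)
      obtain d' where d': "d' \<in> D" "d' [^] n = d"
        using D cd(2) n(1) unfolding divisible_iff by blast
      define x where "x = a \<otimes> inv d'"
      have x: "x \<in> carrier G" using a d' by (simp add: x_def)
      have "x [^] n = a [^] n \<otimes> inv (d' [^] n)"
        using a d' by (simp add: x_def nat_pow_distrib nat_pow_inv)
      also have "\<dots> = c"
        using cd d' by (simp add: m_assoc)
      finally have xn: "x [^] n = c" .
      have ax: "a = x \<otimes> d'"
        using a d' by (simp add: x_def m_assoc)
      have "x \<notin> C"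
      proof
        assume "x \<in> C"
        then show False using aE ax d'(1) by (auto simp: set_mult_def)
      qed
      then obtain m :: int where m: "x [^] m \<in> C <#> D" "x [^] m \<notin> C"
        using adjoin x by blast
      have "a [^] m = x [^] m \<otimes> d' [^] m"
        using ax x d' by (simp add: int_pow_distrib)
      moreover have "d' [^] m \<in> C <#> D"
        using subgroup_int_pow_closed[OF D_sub d'(1)] DE by auto
      ultimately have "a [^] m \<in> C <#> D"
        using m(1) by simp
      then obtain q where "m = int n * q" using n_dvd by blast
      then have "x [^] m = c [^] q"
        using x xn by (simp add: int_pow_int flip: int_pow_pow)
      then have "x [^] m \<in> C"
        using subgroup_int_pow_closed[OF C_sub cd(1)] by simp
      with m(2) show False by simp
    qed
  qed
  then have CD_all: "C <#> D = carrier G"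
    using E.subset by auto

  have "reduced_group (G\<lparr>carrier := C\<rparr>)"
    unfolding reduced_group_def
  proof (intro allI impI)
    fix H
    assume H: "subgroup H (G\<lparr>carrier := C\<rparr>) \<and>
      divisible_group (G\<lparr>carrier := C, carrier := H\<rparr>)"
    then have "subgroup H G"
      using C_sub incl_subgroup by blast
    then have "divisible H"
      using H by (simp add: divisible_def)
    then have "H \<subseteq> C \<inter> D"
      using D_upper H subgroup.subset by fastforce
    then show "H = {\<one>\<^bsub>G\<lparr>carrier := C\<rparr>\<^esub>}"
      using CD subgroup.one_closed[OF \<open>subgroup H G\<close>] by auto
  qed
  then show ?thesis
    using C_sub D CD CD_all by (auto simp: is_reduced_part_def divisible_def)
qed

end

theory Submission
  imports Defs "HOL-Algebra.Free_Abelian_Groups"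
begin

text \<open>
  Both sides of the equivalence are compared with a third condition: for some \<open>N \<ge> 1\<close> the \<open>N\<close>-th
  powers of \<open>A\<close> form a divisible group. For \<open>A = C \<oplus> D\<close> with \<open>C\<close> reduced and \<open>D\<close> divisible, this is
  the same as \<open>C\<close> having bounded period (\<open>bounded_reduced_part_iff\<close>).

  Sufficiency. Over an abelian group, a system prescribes the values of a homomorphism on the rows
  of exponent sums, and a solution is an extension of it to the free abelian group on the variables.
  Unimodularity says that the rows are independent and span a pure subgroup (\<open>unimodular_pure\<close>).
  Such a homomorphism extends if the target is divisible, and for every target it extends up to an
  error in the \<open>p\<close>-th powers; both facts follow from one maximality argument
  (\<open>ex_supplement\<close>, \<open>extend_hom_modulo_powers\<close>). If the \<open>N\<close>-th powers form a divisible
  group, then running through the prime factors of \<open>N\<close> moves the error into that group, where it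
  can be absorbed (\<open>extend_hom_of_divisible_powers\<close>).

  Necessity. The systems \<open>x\<^sub>k = b\<^sub>k x\<^sub>k\<^sub>+\<^sub>1\<^bsup>n\<^sub>k\<^esup>\<close> are unimodular. If for every \<open>N\<close> the group of \<open>N\<close>-th
  powers fails to be divisible, a diagonal choice of the \<open>b\<^sub>k\<close> and \<open>n\<^sub>k\<close> excludes every finite order
  for \<open>x\<^sub>0\<close>, so that the system has no solution in a periodic group
  (\<open>divisible_powers_of_chains_solvable\<close>).
\<close>

section \<open>Divisible subgroups of powers\<close>

text \<open>
  The \<open>N\<close>-th powers form a divisible subgroup; for \<open>N = 1\<close> the whole group is divisible. No
  subgroup is formed, so that the condition can be moved to a subgroup of \<open>G\<close> and back without
  nested changes of the carrier.
\<close>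

definition divisible_powers :: "('a, 'm) monoid_scheme \<Rightarrow> nat \<Rightarrow> bool" where
  "divisible_powers G N \<longleftrightarrow>
    (\<forall>n::nat. n \<ge> 1 \<longrightarrow> (\<forall>g\<in>carrier G. \<exists>h\<in>carrier G. h [^]\<^bsub>G\<^esub> (N * n) = g [^]\<^bsub>G\<^esub> N))"

lemma divisible_powersD:
  assumes "divisible_powers G N" "n \<ge> (1::nat)" "g \<in> carrier G"
  obtains h where "h \<in> carrier G" "h [^]\<^bsub>G\<^esub> (N * n) = g [^]\<^bsub>G\<^esub> N"
  using assms unfolding divisible_powers_def by blast

lemma (in comm_group) subgroup_comm_group:
  assumes "subgroup H G"
  shows "comm_group (G\<lparr>carrier := H\<rparr>)"
proof (rule group.group_comm_groupI)
  show "group (G\<lparr>carrier := H\<rparr>)"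
    using assms is_group by (rule subgroup.subgroup_is_group)
qed (use subgroup.mem_carrier[OF assms] in \<open>auto simp: m_comm\<close>)

lemma (in comm_group) power_hom: "(\<lambda>x. x [^] (n::nat)) \<in> hom G G"
  by (rule homI) (auto simp: nat_pow_distrib)

lemma (in comm_group) subgroup_powers: "subgroup ((\<lambda>x. x [^] (n::nat)) ` carrier G) G"
proof -
  interpret group_hom G G "\<lambda>x. x [^] n" by unfold_locales (rule power_hom)
  show ?thesis by (rule img_is_subgroup)
qed

text \<open>
  The \<open>N\<close>-th powers of \<open>C \<oplus> D\<close> are those of \<open>C\<close> times \<open>D\<close>, as \<open>D\<close> is divisible. So they form a
  divisible group if \<open>N\<close> kills \<open>C\<close>. Conversely, if they do, then comparing components shows that
  the \<open>N\<close>-th powers of \<open>C\<close> are divisible, hence trivial because \<open>C\<close> is reduced.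
\<close>

lemma (in comm_group) bounded_reduced_part_iff:
  assumes "is_reduced_part G C"
  shows "bounded_period (G\<lparr>carrier := C\<rparr>) \<longleftrightarrow> (\<exists>N\<ge>1. divisible_powers G N)"
proof -
  obtain D where C: "subgroup C G" "reduced_group (G\<lparr>carrier := C\<rparr>)"
    and D: "subgroup D G" "divisible_group (G\<lparr>carrier := D\<rparr>)"
    and CD: "C \<inter> D = {\<one>}" "C <#> D = carrier G"
    using assms by (auto simp: is_reduced_part_def)
  interpret C: subgroup C G by (rule C(1))
  interpret D: subgroup D G by (rule D(1))
  have decomp: "\<exists>c\<in>C. \<exists>d\<in>D. g = c \<otimes> d" if "g \<in> carrier G" for g
    using that unfolding CD(2)[symmetric] set_mult_def by blast
  have pow: "x [^]\<^bsub>G\<lparr>carrier := H\<rparr>\<^esub> n = x [^] n" for x H and n :: nat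
    by (simp flip: nat_pow_consistent)
  have Cpow: "c [^] n \<in> C" if "c \<in> C" for c and n :: nat
    using that by (induction n) auto
  have Dpow: "d [^] n \<in> D" if "d \<in> D" for d and n :: nat
    using that by (induction n) auto
  have Ddiv: "\<exists>e\<in>D. e [^] n = d" if "n \<ge> 1" "d \<in> D" for d and n :: nat
    using D(2) that by (auto simp: divisible_group_def pow)
  show ?thesis
  proof
    assume "bounded_period (G\<lparr>carrier := C\<rparr>)"
    then obtain N :: nat where N: "N \<ge> 1" "\<And>c. c \<in> C \<Longrightarrow> c [^] N = \<one>"
      by (auto simp: bounded_period_def pow)
    have "\<exists>h\<in>carrier G. h [^] (N * n) = g [^] N" if n: "n \<ge> 1" and g: "g \<in> carrier G" for g and n :: nat
    proof -
      obtain c d where cd: "c \<in> C" "d \<in> D" "g = c \<otimes> d" using decomp[OF g] by blast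
      obtain e where e: "e \<in> D" "e [^] n = d" using Ddiv[OF n cd(2)] by blast
      have "e [^] (N * n) = d [^] N"
        using e nat_pow_pow[of e n N] by (simp add: mult.commute[of N])
      moreover have "g [^] N = d [^] N" using cd N by (simp add: nat_pow_distrib)
      ultimately show ?thesis using e by auto
    qed
    then show "\<exists>N\<ge>1. divisible_powers G N" using N(1) by (auto simp: divisible_powers_def)
  next
    assume "\<exists>N\<ge>1. divisible_powers G N"
    then obtain N where N: "N \<ge> 1" "divisible_powers G N" by blast
    let ?C = "G\<lparr>carrier := C\<rparr>"
    interpret C': comm_group ?C by (rule subgroup_comm_group[OF C(1)])
    define H where "H = (\<lambda>c. c [^] N) ` C"
    have H: "subgroup H ?C" using C'.subgroup_powers[of N] by (simp add: H_def pow)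
    have "\<exists>h\<in>H. h [^] n = g" if n: "n \<ge> 1" and g: "g \<in> H" for g and n :: nat
    proof -
      obtain c where c: "c \<in> C" "g = c [^] N" using g by (auto simp: H_def)
      obtain h where h: "h \<in> carrier G" "h [^] (N * n) = c [^] N"
        using divisible_powersD[OF N(2) n C.mem_carrier[OF c(1)]] .
      obtain x d where xd: "x \<in> C" "d \<in> D" "h = x \<otimes> d" using decomp[OF h(1)] by blast
      have eq: "x [^] (N * n) \<otimes> d [^] (N * n) = c [^] N"
        using h xd by (simp add: nat_pow_distrib)
      then have "d [^] (N * n) = inv (x [^] (N * n)) \<otimes> c [^] N"
        using xd c by (metis C.mem_carrier D.mem_carrier inv_solve_left nat_pow_closed)
      then have "d [^] (N * n) \<in> C \<inter> D"
        using Cpow xd c Dpow[OF xd(2), of "N * n"] by auto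
      then have "d [^] (N * n) = \<one>" using CD(1) by auto
      then have "(x [^] N) [^] n = g" using eq xd c by (simp add: nat_pow_pow)
      then show ?thesis using xd by (auto simp: H_def)
    qed
    then have "divisible_group (?C\<lparr>carrier := H\<rparr>)"
      by (auto simp: divisible_group_def pow)
    then have "H = {\<one>}" using H C(2) by (auto simp: reduced_group_def)
    then have "c [^] N = \<one>" if "c \<in> C" for c using that by (auto simp: H_def)
    then show "bounded_period ?C" using N(1) by (auto simp: bounded_period_def pow)
  qed
qed


section \<open>Supplements with prescribed intersection\<close>

text \<open>
  The number is the order of the coset of \<open>z\<close> in the quotient by \<open>H\<close>, which is \<open>0\<close> by convention
  when the coset has infinite order.
\<close>

lemma (in comm_group) ex_order_modulo_subgroup:
  assumes H: "subgroup H G" and z: "z \<in> carrier G"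
  shows "\<exists>n::nat. \<forall>m::int. z [^] m \<in> H \<longleftrightarrow> int n dvd m"
proof -
  interpret normal H G using H by (rule subgroup_imp_normal)
  interpret Q: group "G Mod H" by (rule factorgroup_is_group)
  have Hz: "H #> z \<in> carrier (G Mod H)" using z by (auto simp: carrier_FactGroup)
  have "z [^] m \<in> H \<longleftrightarrow> int (Q.ord (H #> z)) dvd m" for m :: int
  proof -
    have "z [^] m \<in> H \<longleftrightarrow> H #> z [^] m = H"
      using z H coset_join1[of H "z [^] m"] coset_join2[of "z [^] m" H] subset by auto
    also have "\<dots> \<longleftrightarrow> (H #> z) [^]\<^bsub>G Mod H\<^esub> m = \<one>\<^bsub>G Mod H\<^esub>"
      using z by (simp add: FactGroup_int_pow)
    also have "\<dots> \<longleftrightarrow> int (Q.ord (H #> z)) dvd m"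
      using Q.int_pow_eq_id[OF Hz] .
    finally show ?thesis .
  qed
  then show ?thesis by blast
qed

lemma (in group) subset_set_mult:
  assumes "subgroup H G" "subgroup K G"
  shows "H \<subseteq> H <#> K" "K \<subseteq> H <#> K"
proof -
  interpret H: subgroup H G by fact
  interpret K: subgroup K G by fact
  show "H \<subseteq> H <#> K"
  proof
    fix x assume "x \<in> H"
    then have "x = x \<otimes> \<one>" by simp
    then show "x \<in> H <#> K" using \<open>x \<in> H\<close> K.one_closed unfolding set_mult_def by blast
  qed
  show "K \<subseteq> H <#> K"
  proof
    fix x assume "x \<in> K"
    then have "x = \<one> \<otimes> x" by simp
    then show "x \<in> H <#> K" using \<open>x \<in> K\<close> H.one_closed unfolding set_mult_def by blast
  qed
qed

lemma (in group) subgroup_Union_chain: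
  assumes "\<K> \<noteq> {}" "\<And>H. H \<in> \<K> \<Longrightarrow> subgroup H G"
    and "\<And>H K. H \<in> \<K> \<Longrightarrow> K \<in> \<K> \<Longrightarrow> H \<subseteq> K \<or> K \<subseteq> H"
  shows "subgroup (\<Union>\<K>) G"
proof (rule subgroupI)
  show "\<Union>\<K> \<subseteq> carrier G"
    using subgroup.subset[OF assms(2)] by auto
  show "\<Union>\<K> \<noteq> {}"
    using assms(1) subgroup.one_closed[OF assms(2)] by auto
  show "inv x \<in> \<Union>\<K>" if "x \<in> \<Union>\<K>" for x
    using that subgroup.m_inv_closed[OF assms(2)] by auto
  show "x \<otimes> y \<in> \<Union>\<K>" if xy: "x \<in> \<Union>\<K>" "y \<in> \<Union>\<K>" for x y
  proof -
    obtain H K where HK: "x \<in> H" "H \<in> \<K>" "y \<in> K" "K \<in> \<K>" using xy by auto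
    then obtain L where "L \<in> \<K>" "x \<in> L" "y \<in> L" using assms(3)[of H K] by blast
    then show ?thesis using subgroup.m_closed[OF assms(2)] by auto
  qed
qed

text \<open>
  The common source of both extension results below. By Zorn's lemma there is a maximal \<open>\<Gamma>\<close> above
  \<open>\<Gamma>\<^sub>0\<close> that meets \<open>V\<close> only inside \<open>\<Gamma>\<^sub>0\<close>. If \<open>n\<close> is the order of an element \<open>z\<close> modulo \<open>\<Gamma> V\<close>, the
  hypothesis allows \<open>z\<close> to be corrected by an element of \<open>V\<close> so that its \<open>n\<close>-th power falls into
  \<open>\<Gamma>\<close> itself (for \<open>n = 0\<close> there is nothing to correct). The corrected element can then be adjoined to \<open>\<Gamma>\<close> without enlarging the intersection
  with \<open>V\<close>, and maximality puts it into \<open>\<Gamma>\<close>.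
\<close>

lemma (in comm_group) ex_supplement:
  assumes \<Gamma>\<^sub>0: "subgroup \<Gamma>\<^sub>0 G" and V: "subgroup V G"
    and corr: "\<And>\<Gamma> z n. subgroup \<Gamma> G \<Longrightarrow> \<Gamma>\<^sub>0 \<subseteq> \<Gamma> \<Longrightarrow> z \<in> carrier G \<Longrightarrow> n \<ge> (1::nat) \<Longrightarrow>
      z [^] n \<in> \<Gamma> <#> V \<Longrightarrow> \<exists>d\<in>V. (z \<otimes> d) [^] n \<in> \<Gamma>"
  shows "\<exists>\<Gamma>. subgroup \<Gamma> G \<and> \<Gamma>\<^sub>0 \<subseteq> \<Gamma> \<and> \<Gamma> \<inter> V \<subseteq> \<Gamma>\<^sub>0 \<and> \<Gamma> <#> V = carrier G"
proof -
  define \<C> where "\<C> = {\<Gamma>. subgroup \<Gamma> G \<and> \<Gamma>\<^sub>0 \<subseteq> \<Gamma> \<and> \<Gamma> \<inter> V \<subseteq> \<Gamma>\<^sub>0}"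
  have "\<exists>\<Gamma>\<in>\<C>. \<forall>H\<in>\<C>. \<Gamma> \<subseteq> H \<longrightarrow> H = \<Gamma>"
  proof (rule subset_Zorn_nonempty)
    show "\<C> \<noteq> {}" using \<Gamma>\<^sub>0 by (auto simp: \<C>_def)
    fix \<K> assume \<K>: "\<K> \<noteq> {}" "subset.chain \<C> \<K>"
    then have "subgroup (\<Union>\<K>) G"
      by (intro subgroup_Union_chain) (auto simp: \<C>_def subset_chain_def)
    then show "\<Union>\<K> \<in> \<C>" using \<K> by (fastforce simp: \<C>_def subset_chain_def)
  qed
  then obtain \<Gamma> where \<Gamma>: "subgroup \<Gamma> G" "\<Gamma>\<^sub>0 \<subseteq> \<Gamma>" "\<Gamma> \<inter> V \<subseteq> \<Gamma>\<^sub>0"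
    and max: "\<And>H. subgroup H G \<Longrightarrow> \<Gamma>\<^sub>0 \<subseteq> H \<Longrightarrow> H \<inter> V \<subseteq> \<Gamma>\<^sub>0 \<Longrightarrow> \<Gamma> \<subseteq> H \<Longrightarrow> H = \<Gamma>"
    by (auto simp: \<C>_def)
  interpret \<Gamma>: subgroup \<Gamma> G by (rule \<Gamma>(1))
  interpret V: subgroup V G by (rule V)
  have \<Gamma>V: "subgroup (\<Gamma> <#> V) G" by (rule mult_subgroups[OF \<Gamma>(1) V])
  interpret \<Gamma>V: subgroup "\<Gamma> <#> V" G by (rule \<Gamma>V)
  have "z \<in> \<Gamma> <#> V" if z: "z \<in> carrier G" for z
  proof -
    obtain n :: nat where n: "\<And>m::int. z [^] m \<in> \<Gamma> <#> V \<longleftrightarrow> int n dvd m"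
      using ex_order_modulo_subgroup[OF \<Gamma>V z] by blast
    obtain d where d: "d \<in> V" "(z \<otimes> d) [^] n \<in> \<Gamma>"
    proof (cases "n = 0")
      case True
      then show ?thesis using that[of \<one>] V.one_closed \<Gamma>.one_closed by simp
    next
      case False
      moreover have "z [^] n \<in> \<Gamma> <#> V" using n[of "int n"] by (simp add: int_pow_int)
      ultimately show ?thesis using corr[OF \<Gamma>(1,2) z, of n] that by auto
    qed
    define y where "y = z \<otimes> d"
    have y: "y \<in> carrier G" using z d by (simp add: y_def)
    have Y: "subgroup (generate G {y}) G" using y by (intro generate_is_subgroup) auto
    note sub = subset_set_mult[OF \<Gamma>(1) Y]
    have "v \<in> \<Gamma>\<^sub>0" if v: "v \<in> \<Gamma> <#> generate G {y}" "v \<in> V" for v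
    proof -
      obtain g m where g: "g \<in> \<Gamma>" "v = g \<otimes> y [^] (m::int)"
        using v(1) generate_pow[OF y] by (auto simp: set_mult_def)
      have "z [^] m = inv g \<otimes> (v \<otimes> inv (d [^] m))"
        using g z d by (simp add: y_def int_pow_distrib m_assoc) (simp add: m_assoc[symmetric])
      moreover have "inv g \<in> \<Gamma>" "v \<otimes> inv (d [^] m) \<in> V"
        using g(1) v(2) subgroup_int_pow_closed[OF V d(1)] by auto
      then have "inv g \<otimes> (v \<otimes> inv (d [^] m)) \<in> \<Gamma> <#> V"
        unfolding set_mult_def by blast
      ultimately have "z [^] m \<in> \<Gamma> <#> V" by simp
      then obtain k where k: "m = int n * k" unfolding n by (rule dvdE)
      have "y [^] m = (y [^] n) [^] k"
        using y by (simp add: k int_pow_int flip: int_pow_pow)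
      also have "\<dots> \<in> \<Gamma>"
        using subgroup_int_pow_closed[OF \<Gamma>(1)] d(2) by (simp add: y_def)
      finally show ?thesis using g v \<Gamma>(3) by auto
    qed
    then have "\<Gamma> <#> generate G {y} = \<Gamma>"
      using max[OF mult_subgroups[OF \<Gamma>(1) Y]] sub \<Gamma>(2) by blast
    then have "y \<in> \<Gamma>"
      using sub(2) generate.incl[of y "{y}" G] by auto
    moreover have "z = y \<otimes> inv d" using z d by (simp add: y_def m_assoc)
    ultimately show ?thesis using d by (auto simp: set_mult_def)
  qed
  then have "\<Gamma> <#> V = carrier G" using \<Gamma>V.subset by auto
  then show ?thesis using \<Gamma> by blast
qed


section \<open>Extending homomorphisms to free abelian groups\<close>

lemma DirProd_nat_pow:
  "(x, y) [^]\<^bsub>G \<times>\<times> H\<^esub> (n::nat) = (x [^]\<^bsub>G\<^esub> n, y [^]\<^bsub>H\<^esub> n)"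
  by (induction n) (simp_all add: nat_pow_def)

lemma comm_group_DirProd:
  assumes "comm_group G" "comm_group H"
  shows "comm_group (G \<times>\<times> H)"
proof -
  interpret G: comm_group G by fact
  interpret H: comm_group H by fact
  have "group (G \<times>\<times> H)" by (intro DirProd_group G.is_group H.is_group)
  then show ?thesis
    by (rule group.group_comm_groupI) (auto simp: G.m_comm H.m_comm)
qed

text \<open>
  The assignment \<open>\<rho> c \<mapsto> \<beta> c\<close> need not be a map, so it is treated as a subgroup of \<open>F \<times> G\<close> and extended
  to a relation \<open>\<Gamma>\<close> defined on all of \<open>F\<close>, single-valued modulo \<open>q\<close>-th powers. Start from the graph
  enlarged by all \<open>q\<close>-th powers of \<open>F \<times> G\<close>; purity says exactly that this start is single-valued
  modulo \<open>q\<close>-th powers. A supplement of \<open>V = 1 \<times> G\<close> is a relation with full domain, and it keeps the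
  indeterminacy. The correction needed for a supplement amounts to dividing a value \<open>g\<close> of
  \<open>x\<^sup>n\<close> by \<open>n\<close>: this is possible outright in a divisible group (\<open>q = 0\<close>), and possible modulo
  \<open>q\<close>-th powers for a prime \<open>q\<close>, because either \<open>q\<close> is coprime to \<open>n\<close>, or \<open>x\<^sup>n\<close> is a \<open>q\<close>-th power
  and so may be assigned the value \<open>1\<close>.
\<close>

lemma (in comm_group) extend_relation_modulo_powers:
  fixes q :: nat
  assumes E: "comm_group E" and F: "comm_group F"
    and \<rho>: "\<rho> \<in> hom E F" and \<beta>: "\<beta> \<in> hom E G"
    and pure: "\<And>c f. c \<in> carrier E \<Longrightarrow> f \<in> carrier F \<Longrightarrow> \<rho> c = f [^]\<^bsub>F\<^esub> q \<Longrightarrow>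
      \<exists>c'\<in>carrier E. c = c' [^]\<^bsub>E\<^esub> q"
    and q: "q = 0 \<and> divisible_powers G 1 \<or> Factorial_Ring.prime q"
  shows "\<exists>\<Gamma>. subgroup \<Gamma> (F \<times>\<times> G) \<and> (\<forall>c\<in>carrier E. (\<rho> c, \<beta> c) \<in> \<Gamma>) \<and>
    (\<forall>f\<in>carrier F. \<exists>g\<in>carrier G. (f, g) \<in> \<Gamma>) \<and>
    (\<forall>g. (\<one>\<^bsub>F\<^esub>, g) \<in> \<Gamma> \<longrightarrow> (\<exists>a\<in>carrier G. g = a [^] q))"
proof -
  interpret E: comm_group E by fact
  interpret F: comm_group F by fact
  interpret \<rho>: group_hom E F \<rho> by unfold_locales (rule \<rho>)
  interpret \<beta>: group_hom E G \<beta> by unfold_locales (rule \<beta>)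
  define P where "P = F \<times>\<times> G"
  interpret P: comm_group P
    unfolding P_def by (intro comm_group_DirProd F comm_group_axioms)
  have P_carrier: "(x, y) \<in> carrier P \<longleftrightarrow> x \<in> carrier F \<and> y \<in> carrier G" for x y
    by (simp add: P_def)
  have P_mult: "(x, y) \<otimes>\<^bsub>P\<^esub> (x', y') = (x \<otimes>\<^bsub>F\<^esub> x', y \<otimes> y')" for x y x' y'
    by (simp add: P_def)
  have P_pow: "(x, y) [^]\<^bsub>P\<^esub> (n::nat) = (x [^]\<^bsub>F\<^esub> n, y [^] n)" for x y n
    by (simp add: P_def DirProd_nat_pow)
  have "(\<lambda>c. (\<rho> c, \<beta> c)) \<in> hom E P"
    by (rule homI) (auto simp: P_carrier P_mult)
  then interpret graph: group_hom E P "\<lambda>c. (\<rho> c, \<beta> c)" by unfold_locales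
  \<comment> \<open>The graph, the indeterminacy and the vertical subgroup of the relation to be built.\<close>
  define Gr where "Gr = (\<lambda>c. (\<rho> c, \<beta> c)) ` carrier E"
  have Gr: "subgroup Gr P" unfolding Gr_def by (rule graph.img_is_subgroup)
  define Pq where "Pq = (\<lambda>z. z [^]\<^bsub>P\<^esub> q) ` carrier P"
  have Pq: "subgroup Pq P" unfolding Pq_def by (rule P.subgroup_powers)
  define V where "V = (\<lambda>g. (\<one>\<^bsub>F\<^esub>, g)) ` carrier G"
  have "(\<lambda>g. (\<one>\<^bsub>F\<^esub>, g)) \<in> hom G P"
    by (rule homI) (auto simp: P_carrier P_mult)
  then interpret V: group_hom G P "\<lambda>g. (\<one>\<^bsub>F\<^esub>, g)" by unfold_locales
  note [simp del] = V.hom_mult V.hom_inv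
  have V: "subgroup V P" unfolding V_def by (rule V.img_is_subgroup)
  note sub = P.subset_set_mult[OF Gr Pq]
  \<comment> \<open>An element \<open>(x, h)\<close> of \<open>F \<times> G\<close> can be corrected in its second component only.\<close>
  have corr: "\<exists>d\<in>V. (z \<otimes>\<^bsub>P\<^esub> d) [^]\<^bsub>P\<^esub> n \<in> \<Gamma>"
    if \<Gamma>: "subgroup \<Gamma> P" "Gr <#>\<^bsub>P\<^esub> Pq \<subseteq> \<Gamma>" and z: "z \<in> carrier P" and n: "n \<ge> 1"
      and zn: "z [^]\<^bsub>P\<^esub> n \<in> \<Gamma> <#>\<^bsub>P\<^esub> V" for \<Gamma> z and n :: nat
  proof -
    obtain x h where xh: "z = (x, h)" "x \<in> carrier F" "h \<in> carrier G"
      using z by (cases z) (auto simp: P_carrier)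
    obtain f g v where fgv: "(f, g) \<in> \<Gamma>" "v \<in> carrier G"
        "z [^]\<^bsub>P\<^esub> n = (f, g) \<otimes>\<^bsub>P\<^esub> (\<one>\<^bsub>F\<^esub>, v)"
      using zn by (auto simp: set_mult_def V_def)
    have fg: "f \<in> carrier F" "g \<in> carrier G"
      using subgroup.mem_carrier[OF \<Gamma>(1) fgv(1)] by (auto simp: P_carrier)
    with fgv xh have xg: "(x [^]\<^bsub>F\<^esub> n, g) \<in> \<Gamma>" by (simp add: P_pow P_mult)
    \<comment> \<open>The value of \<open>x\<^sup>n\<close> can be changed to an \<open>n\<close>-th power; then \<open>h\<inverse> e\<close> corrects \<open>z\<close>.\<close>
    have "\<exists>e\<in>carrier G. (x [^]\<^bsub>F\<^esub> n, e [^] n) \<in> \<Gamma>"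
    proof (cases "q = 0")
      case True
      then have "divisible_powers G 1" using q by auto
      then obtain e where "e \<in> carrier G" "e [^] (1 * n) = g [^] (1::nat)"
        using n fg(2) by (rule divisible_powersD)
      then show ?thesis using xg fg by (intro bexI[of _ e]) auto
    next
      case False
      then have prime: "Factorial_Ring.prime q" using q by auto
      show ?thesis
      proof (cases "q dvd n")
        case True
        then obtain m where "n = q * m" by (rule dvdE)
        then have m: "n = m * q" by simp
        have "(x [^]\<^bsub>F\<^esub> m, \<one>) [^]\<^bsub>P\<^esub> q \<in> Pq"
          using xh by (auto simp: Pq_def P_carrier)
        then have "(x [^]\<^bsub>F\<^esub> n, \<one> [^] n) \<in> \<Gamma>"
          using sub(2) \<Gamma>(2) xh by (auto simp: P_pow F.nat_pow_pow m)
        then show ?thesis by blast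
      next
        case False
        then have "coprime (int n) (int q)"
          using prime_imp_coprime[OF prime False] by (simp add: coprime_commute)
        then obtain k l where kl: "k * int n + l * int q = 1"
          using bezout_int[of "int n" "int q"] by auto
        have "(\<one>\<^bsub>F\<^esub>, g [^] (- l)) [^]\<^bsub>P\<^esub> q \<in> Pq"
          using fg by (auto simp: Pq_def P_carrier)
        moreover have "(g [^] (- l)) [^] q = g [^] (- l * int q)"
          using fg by (simp add: int_pow_pow flip: int_pow_int)
        ultimately have "(\<one>\<^bsub>F\<^esub>, g [^] (- l * int q)) \<in> \<Gamma>"
          using sub(2) \<Gamma>(2) by (auto simp: P_pow)
        then have "(x [^]\<^bsub>F\<^esub> n, g) \<otimes>\<^bsub>P\<^esub> (\<one>\<^bsub>F\<^esub>, g [^] (- l * int q)) \<in> \<Gamma>"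
          using xg subgroup.m_closed[OF \<Gamma>(1)] by blast
        moreover have "g \<otimes> g [^] (- l * int q) = g [^] (1 + (- l * int q))"
          using int_pow_mult[OF fg(2), of 1 "- l * int q"] fg by simp
        moreover have "1 + (- l * int q) = k * int n" using kl by simp
        moreover have "g [^] (k * int n) = (g [^] k) [^] n"
          using fg by (simp add: int_pow_pow flip: int_pow_int)
        ultimately have "(x [^]\<^bsub>F\<^esub> n, (g [^] k) [^] n) \<in> \<Gamma>"
          using xh by (simp add: P_mult)
        then show ?thesis using fg by blast
      qed
    qed
    then obtain e where e: "e \<in> carrier G" "(x [^]\<^bsub>F\<^esub> n, e [^] n) \<in> \<Gamma>" by blast
    have "z \<otimes>\<^bsub>P\<^esub> (\<one>\<^bsub>F\<^esub>, inv h \<otimes> e) = (x, e)"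
      using xh e m_assoc[of h "inv h" e] by (simp add: P_mult)
    then show ?thesis
      using xh e by (intro bexI[of _ "(\<one>\<^bsub>F\<^esub>, inv h \<otimes> e)"]) (auto simp: P_pow V_def)
  qed
  obtain \<Gamma> where \<Gamma>: "subgroup \<Gamma> P" "Gr <#>\<^bsub>P\<^esub> Pq \<subseteq> \<Gamma>" "\<Gamma> \<inter> V \<subseteq> Gr <#>\<^bsub>P\<^esub> Pq"
      "\<Gamma> <#>\<^bsub>P\<^esub> V = carrier P"
    using P.ex_supplement[OF P.mult_subgroups[OF Gr Pq] V corr] by blast
  have 1: "(\<rho> c, \<beta> c) \<in> \<Gamma>" if "c \<in> carrier E" for c
    using that sub(1) \<Gamma>(2) by (auto simp: Gr_def)
  have 2: "\<exists>g\<in>carrier G. (f, g) \<in> \<Gamma>" if f: "f \<in> carrier F" for f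
  proof -
    have "(f, \<one>) \<in> \<Gamma> <#>\<^bsub>P\<^esub> V" using f \<Gamma>(4) by (simp add: P_carrier)
    then obtain f' g v where fgv: "(f', g) \<in> \<Gamma>" "v \<in> carrier G" "(f, \<one>) = (f', g) \<otimes>\<^bsub>P\<^esub> (\<one>\<^bsub>F\<^esub>, v)"
      by (auto simp: set_mult_def V_def)
    moreover have "f' \<in> carrier F" "g \<in> carrier G"
      using subgroup.mem_carrier[OF \<Gamma>(1) fgv(1)] by (auto simp: P_carrier)
    ultimately show ?thesis by (auto simp: P_mult)
  qed
  have 3: "\<exists>a\<in>carrier G. g = a [^] q" if g: "(\<one>\<^bsub>F\<^esub>, g) \<in> \<Gamma>" for g
  proof -
    have "g \<in> carrier G" using subgroup.mem_carrier[OF \<Gamma>(1) g] by (auto simp: P_carrier)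
    then have "(\<one>\<^bsub>F\<^esub>, g) \<in> Gr <#>\<^bsub>P\<^esub> Pq" using g \<Gamma>(3) by (auto simp: V_def)
    then obtain c f a where cfa: "c \<in> carrier E" "f \<in> carrier F" "a \<in> carrier G"
        "\<one>\<^bsub>F\<^esub> = \<rho> c \<otimes>\<^bsub>F\<^esub> f [^]\<^bsub>F\<^esub> q" "g = \<beta> c \<otimes> a [^] q"
      by (auto simp: set_mult_def Gr_def Pq_def P_carrier P_mult P_pow)
    then have "\<rho> c = inv\<^bsub>F\<^esub> (f [^]\<^bsub>F\<^esub> q)"
      using F.inv_equality[of "\<rho> c" "f [^]\<^bsub>F\<^esub> q"] by simp
    then have "\<rho> c = (inv\<^bsub>F\<^esub> f) [^]\<^bsub>F\<^esub> q" using cfa by (simp add: F.nat_pow_inv)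
    then obtain c' where c': "c' \<in> carrier E" "c = c' [^]\<^bsub>E\<^esub> q"
      using pure[of c "inv\<^bsub>F\<^esub> f"] cfa by auto
    then have "g = (\<beta> c' \<otimes> a) [^] q"
      using cfa by (simp add: nat_pow_distrib \<beta>.hom_nat_pow)
    then show ?thesis using c'(1) cfa(3) by (intro bexI[of _ "\<beta> c' \<otimes> a"]) auto
  qed
  show ?thesis
    using \<Gamma>(1) 1 2 3 unfolding P_def by (intro exI[of _ \<Gamma>]) simp
qed

text \<open>
  Over a free abelian group the relation can be turned into a homomorphism by choosing values on
  the basis only. For \<open>q = 0\<close> the extension is exact.
\<close>

lemma (in comm_group) extend_hom_modulo_powers:
  fixes q :: nat
  assumes E: "comm_group E" and \<rho>: "\<rho> \<in> hom E (free_Abelian_group J)" and \<beta>: "\<beta> \<in> hom E G"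
    and pure: "\<And>c f. c \<in> carrier E \<Longrightarrow> f \<in> carrier (free_Abelian_group J) \<Longrightarrow>
      \<rho> c = f [^]\<^bsub>free_Abelian_group J\<^esub> q \<Longrightarrow> \<exists>c'\<in>carrier E. c = c' [^]\<^bsub>E\<^esub> q"
    and q: "q = 0 \<and> divisible_powers G 1 \<or> Factorial_Ring.prime q"
  shows "\<exists>\<sigma>\<in>hom (free_Abelian_group J) G. \<forall>c\<in>carrier E. \<exists>a\<in>carrier G. \<beta> c = \<sigma> (\<rho> c) \<otimes> a [^] q"
proof -
  let ?F = "free_Abelian_group J"
  interpret F: comm_group ?F by (rule abelian_free_Abelian_group)
  have "\<exists>\<Gamma>. subgroup \<Gamma> (?F \<times>\<times> G) \<and> (\<forall>c\<in>carrier E. (\<rho> c, \<beta> c) \<in> \<Gamma>) \<and>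
      (\<forall>f\<in>carrier ?F. \<exists>g\<in>carrier G. (f, g) \<in> \<Gamma>) \<and>
      (\<forall>g. (\<one>\<^bsub>?F\<^esub>, g) \<in> \<Gamma> \<longrightarrow> (\<exists>a\<in>carrier G. g = a [^] q))"
    by (rule extend_relation_modulo_powers[OF E F.comm_group_axioms \<rho> \<beta> _ q]) (rule pure; assumption)
  then obtain \<Gamma> where \<Gamma>: "subgroup \<Gamma> (?F \<times>\<times> G)" "\<And>c. c \<in> carrier E \<Longrightarrow> (\<rho> c, \<beta> c) \<in> \<Gamma>"
      "\<And>f. f \<in> carrier ?F \<Longrightarrow> \<exists>g\<in>carrier G. (f, g) \<in> \<Gamma>"
      "\<And>g. (\<one>\<^bsub>?F\<^esub>, g) \<in> \<Gamma> \<Longrightarrow> \<exists>a\<in>carrier G. g = a [^] q"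
    by blast
  interpret P: group "?F \<times>\<times> G" by (intro DirProd_group F.is_group is_group)
  have "\<forall>j\<in>J. \<exists>g\<in>carrier G. (frag_of j, g) \<in> \<Gamma>" by (auto intro: \<Gamma>(3))
  then obtain s where s: "\<And>j. j \<in> J \<Longrightarrow> s j \<in> carrier G \<and> (frag_of j, s j) \<in> \<Gamma>" by metis
  then have "s ` J \<subseteq> carrier G" by auto
  then obtain \<sigma> where \<sigma>: "\<sigma> \<in> hom ?F G" "\<And>j. j \<in> J \<Longrightarrow> \<sigma> (frag_of j) = s j"
    using free_Abelian_group_universal[of s J] by blast
  interpret \<sigma>: group_hom ?F G \<sigma> by unfold_locales (rule \<sigma>(1))
  have \<Gamma>_diff: "(x \<otimes>\<^bsub>?F\<^esub> inv\<^bsub>?F\<^esub> y, g \<otimes> inv h) \<in> \<Gamma>" if "(x, g) \<in> \<Gamma>" "(y, h) \<in> \<Gamma>" for x y g h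
  proof -
    have yh: "y \<in> carrier ?F" "h \<in> carrier G"
      using subgroup.mem_carrier[OF \<Gamma>(1) that(2)] by auto
    have "(x, g) \<otimes>\<^bsub>?F \<times>\<times> G\<^esub> inv\<^bsub>?F \<times>\<times> G\<^esub> (y, h) \<in> \<Gamma>"
      using that \<Gamma>(1) by (simp add: subgroup.m_closed subgroup.m_inv_closed)
    then show ?thesis using yh F.is_group is_group by (simp del: inv_free_Abelian_group)
  qed
  have \<sigma>\<Gamma>: "(f, \<sigma> f) \<in> \<Gamma>" if "Poly_Mapping.keys f \<subseteq> J" for f
    using that
  proof (induction f rule: free_Abelian_group_induct[consumes 1, case_names zero diff one])
    case zero
    then show ?case using subgroup.one_closed[OF \<Gamma>(1)] \<sigma>.hom_one by simp
  next
    case (diff x y)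
    then have "\<sigma> (x - y) = \<sigma> x \<otimes> inv (\<sigma> y)"
      using \<sigma>.hom_mult[of x "- y"] \<sigma>.hom_inv[of y] by simp
    then show ?case using \<Gamma>_diff[OF diff.IH] diff.hyps by simp
  next
    case (one a)
    then show ?case using s \<sigma>(2) by auto
  qed
  have "\<exists>a\<in>carrier G. \<beta> c = \<sigma> (\<rho> c) \<otimes> a [^] q" if c: "c \<in> carrier E" for c
  proof -
    have \<rho>c: "\<rho> c \<in> carrier ?F" and \<beta>c: "\<beta> c \<in> carrier G"
      using hom_in_carrier[OF \<rho> c] hom_in_carrier[OF \<beta> c] by auto
    then have "(\<one>\<^bsub>?F\<^esub>, \<beta> c \<otimes> inv \<sigma> (\<rho> c)) \<in> \<Gamma>"
      using \<Gamma>_diff[OF \<Gamma>(2)[OF c] \<sigma>\<Gamma>[of "\<rho> c"]] by simp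
    then obtain a where a: "a \<in> carrier G" "\<beta> c \<otimes> inv \<sigma> (\<rho> c) = a [^] q"
      using \<Gamma>(4) by blast
    then have "\<beta> c = \<sigma> (\<rho> c) \<otimes> a [^] q"
      using \<rho>c \<beta>c \<sigma>.hom_closed[OF \<rho>c]
      by (metis inv_solve_right' m_comm nat_pow_closed)
    then show ?thesis using a by blast
  qed
  then show ?thesis using \<sigma>(1) by blast
qed

text \<open>
  Extend modulo \<open>p\<close>-th powers for a prime divisor \<open>p\<close> of \<open>N\<close>. The remaining error is a homomorphism
  into the subgroup \<open>B\<close> of \<open>p\<close>-th powers, whose own \<open>(N / p)\<close>-th powers are the \<open>N\<close>-th powers of \<open>G\<close>;
  by induction on \<open>N\<close> it extends exactly, and the two extensions are multiplied. The induction ends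
  at \<open>N = 1\<close>, where the group is divisible.
\<close>

lemma extend_hom_of_divisible_powers:
  assumes "comm_group G" and "N \<ge> 1" and "divisible_powers G N"
    and E: "comm_group E" and \<rho>: "\<rho> \<in> hom E (free_Abelian_group J)" and "\<beta> \<in> hom E G"
    and pure: "\<And>q c f. q = 0 \<or> Factorial_Ring.prime q \<Longrightarrow> c \<in> carrier E \<Longrightarrow>
      f \<in> carrier (free_Abelian_group J) \<Longrightarrow> \<rho> c = f [^]\<^bsub>free_Abelian_group J\<^esub> (q::nat) \<Longrightarrow>
      \<exists>c'\<in>carrier E. c = c' [^]\<^bsub>E\<^esub> q"
  shows "\<exists>\<sigma>\<in>hom (free_Abelian_group J) G. \<forall>c\<in>carrier E. \<sigma> (\<rho> c) = \<beta> c"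
  using assms(1-3) \<open>\<beta> \<in> hom E G\<close>
proof (induction N arbitrary: G \<beta> rule: less_induct)
  case (less N G \<beta>)
  let ?F = "free_Abelian_group J"
  interpret F: comm_group ?F by (rule abelian_free_Abelian_group)
  interpret G: comm_group G by fact
  interpret E: comm_group E by fact
  interpret \<rho>: group_hom E ?F \<rho> by unfold_locales (rule \<rho>)
  interpret \<beta>: group_hom E G \<beta> by unfold_locales (rule less.prems)
  show ?case
  proof (cases "N = 1")
    case True
    have "\<exists>\<sigma>\<in>hom ?F G. \<forall>c\<in>carrier E. \<exists>a\<in>carrier G. \<beta> c = \<sigma> (\<rho> c) \<otimes>\<^bsub>G\<^esub> a [^]\<^bsub>G\<^esub> (0::nat)"
      by (rule G.extend_hom_modulo_powers[OF E \<rho> less.prems(4)])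
        (rule pure, use True less.prems(3) in auto)
    then obtain \<sigma> where \<sigma>: "\<sigma> \<in> hom ?F G"
      "\<And>c. c \<in> carrier E \<Longrightarrow> \<exists>a\<in>carrier G. \<beta> c = \<sigma> (\<rho> c) \<otimes>\<^bsub>G\<^esub> a [^]\<^bsub>G\<^esub> (0::nat)" by blast
    have "\<sigma> (\<rho> c) = \<beta> c" if c: "c \<in> carrier E" for c
      using \<sigma>(2)[OF c] hom_in_carrier[OF \<sigma>(1) \<rho>.hom_closed[OF c]] by simp
    then show ?thesis using \<sigma>(1) by blast
  next
    case False
    then obtain p where p: "Factorial_Ring.prime p" "p dvd N" using prime_factor_nat by blast
    then obtain M where M: "N = p * M" by blast
    then have MN: "M < N" "M \<ge> 1" using less.prems(2) prime_gt_1_nat[OF p(1)] by auto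
    define B where "B = (\<lambda>x. x [^]\<^bsub>G\<^esub> p) ` carrier G"
    define H where "H = G\<lparr>carrier := B\<rparr>"
    have B: "subgroup B G" unfolding B_def by (rule G.subgroup_powers)
    have H: "comm_group H" unfolding H_def
      using B by (rule G.subgroup_comm_group)
    interpret H: comm_group H by (rule H)
    have H_pow: "x [^]\<^bsub>H\<^esub> (n::nat) = x [^]\<^bsub>G\<^esub> n" for x n
      by (simp add: H_def flip: G.nat_pow_consistent)
    have H_simps: "carrier H = B" "\<And>x y. x \<otimes>\<^bsub>H\<^esub> y = x \<otimes>\<^bsub>G\<^esub> y" by (simp_all add: H_def)
    have BG: "x \<in> carrier G" if "x \<in> B" for x using that subgroup.mem_carrier[OF B] by blast
    have "\<exists>h\<in>carrier H. h [^]\<^bsub>H\<^esub> (M * n) = b [^]\<^bsub>H\<^esub> M" if b: "b \<in> carrier H" and n: "n \<ge> 1" for b and n :: nat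
    proof -
      obtain g where g: "g \<in> carrier G" "b = g [^]\<^bsub>G\<^esub> p" using b by (auto simp: H_simps B_def)
      obtain h where h: "h \<in> carrier G" "h [^]\<^bsub>G\<^esub> (N * n) = g [^]\<^bsub>G\<^esub> N"
        using divisible_powersD[OF less.prems(3) n g(1)] .
      have "(h [^]\<^bsub>G\<^esub> p) [^]\<^bsub>G\<^esub> (M * n) = b [^]\<^bsub>G\<^esub> M"
        using h g by (simp add: G.nat_pow_pow M mult.assoc)
      then show ?thesis using h by (intro bexI[of _ "h [^]\<^bsub>G\<^esub> p"]) (auto simp: H_pow H_simps B_def)
    qed
    then have "divisible_powers H M" by (auto simp: divisible_powers_def)
    have "\<exists>\<sigma>\<in>hom ?F G. \<forall>c\<in>carrier E. \<exists>a\<in>carrier G. \<beta> c = \<sigma> (\<rho> c) \<otimes>\<^bsub>G\<^esub> a [^]\<^bsub>G\<^esub> p"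
      by (rule G.extend_hom_modulo_powers[OF E \<rho> less.prems(4)])
        (rule pure, use p in auto)
    then obtain \<sigma> where \<sigma>: "\<sigma> \<in> hom ?F G"
      "\<And>c. c \<in> carrier E \<Longrightarrow> \<exists>a\<in>carrier G. \<beta> c = \<sigma> (\<rho> c) \<otimes>\<^bsub>G\<^esub> a [^]\<^bsub>G\<^esub> p" by blast
    interpret \<sigma>: group_hom ?F G \<sigma> by unfold_locales (rule \<sigma>(1))
    define \<beta>' where "\<beta>' c = inv\<^bsub>G\<^esub> \<sigma> (\<rho> c) \<otimes>\<^bsub>G\<^esub> \<beta> c" for c
    have \<sigma>\<rho>: "\<sigma> (\<rho> c) \<in> carrier G" if "c \<in> carrier E" for c
      using that \<sigma>.hom_closed \<rho>.hom_closed by blast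
    have "\<beta>' \<in> hom E H"
    proof (rule homI)
      fix c assume c: "c \<in> carrier E"
      then obtain a where "a \<in> carrier G" "\<beta> c = \<sigma> (\<rho> c) \<otimes>\<^bsub>G\<^esub> a [^]\<^bsub>G\<^esub> p" using \<sigma>(2) by blast
      then have "\<beta>' c = a [^]\<^bsub>G\<^esub> p" using \<sigma>\<rho>[OF c] by (simp add: \<beta>'_def flip: G.m_assoc)
      then show "\<beta>' c \<in> carrier H" using \<open>a \<in> carrier G\<close> by (auto simp: H_simps B_def)
    next
      fix c d assume cd: "c \<in> carrier E" "d \<in> carrier E"
      have "\<sigma> (\<rho> (c \<otimes>\<^bsub>E\<^esub> d)) = \<sigma> (\<rho> c) \<otimes>\<^bsub>G\<^esub> \<sigma> (\<rho> d)"
        using cd \<rho>.hom_mult[OF cd] \<sigma>.hom_mult[OF \<rho>.hom_closed \<rho>.hom_closed] by simp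
      then show "\<beta>' (c \<otimes>\<^bsub>E\<^esub> d) = \<beta>' c \<otimes>\<^bsub>H\<^esub> \<beta>' d"
        using cd \<sigma>\<rho> by (simp add: \<beta>'_def H_simps G.inv_mult G.m_ac)
    qed
    then obtain \<tau> where \<tau>: "\<tau> \<in> hom ?F H" "\<And>c. c \<in> carrier E \<Longrightarrow> \<tau> (\<rho> c) = \<beta>' c"
      using less.IH[OF MN(1) H MN(2) \<open>divisible_powers H M\<close>] by blast
    have \<tau>_closed: "\<tau> f \<in> carrier G" if "f \<in> carrier ?F" for f
      using hom_in_carrier[OF \<tau>(1) that] BG by (simp add: H_simps)
    have "(\<lambda>f. \<sigma> f \<otimes>\<^bsub>G\<^esub> \<tau> f) \<in> hom ?F G"
    proof (rule homI)
      fix f g assume fg: "f \<in> carrier ?F" "g \<in> carrier ?F"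
      show "\<sigma> (f \<otimes>\<^bsub>?F\<^esub> g) \<otimes>\<^bsub>G\<^esub> \<tau> (f \<otimes>\<^bsub>?F\<^esub> g) = (\<sigma> f \<otimes>\<^bsub>G\<^esub> \<tau> f) \<otimes>\<^bsub>G\<^esub> (\<sigma> g \<otimes>\<^bsub>G\<^esub> \<tau> g)"
        using \<sigma>.hom_mult[OF fg] hom_mult[OF \<tau>(1) fg] \<sigma>.hom_closed fg \<tau>_closed
        by (simp add: H_simps G.m_ac)
    qed (use \<sigma>.hom_closed \<tau>_closed in auto)
    moreover have "\<sigma> (\<rho> c) \<otimes>\<^bsub>G\<^esub> \<tau> (\<rho> c) = \<beta> c" if "c \<in> carrier E" for c
      using that \<sigma>\<rho> \<tau>(2) by (simp add: \<beta>'_def flip: G.m_assoc)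
    ultimately show ?thesis by (intro bexI[of _ "\<lambda>f. \<sigma> f \<otimes>\<^bsub>G\<^esub> \<tau> f"]) auto
  qed
qed


section \<open>Unimodular systems as pure embeddings\<close>

primrec letter_row :: "('a, 'x) letter \<Rightarrow> 'x \<Rightarrow>\<^sub>0 int" where
  "letter_row (Const g) = 0"
| "letter_row (Var x e) = (if e then frag_of x else - frag_of x)"

text \<open>
  The exponent sums of a word as an element of the free abelian group on the variables.
\<close>

definition word_row :: "('a, 'x) letter list \<Rightarrow> 'x \<Rightarrow>\<^sub>0 int" where
  "word_row u = (\<Sum>l\<leftarrow>u. letter_row l)"

lemma lookup_word_row: "Poly_Mapping.lookup (word_row u) x = word_exponent_sum x u"
proof (induction u)
  case (Cons l u)
  have "Poly_Mapping.lookup (letter_row l) x = letter_exponent x l" by (cases l) auto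
  with Cons show ?case by (simp add: word_row_def word_exponent_sum_def lookup_add)
qed (simp add: word_row_def word_exponent_sum_def)

lemma keys_word_row:
  assumes "u \<in> words G J"
  shows "Poly_Mapping.keys (word_row u) \<subseteq> J"
  using assms
proof (induction u)
  case (Cons l u)
  then have "Poly_Mapping.keys (letter_row l) \<subseteq> J"
    by (cases l) (auto simp: words_def letters_def keys_minus)
  moreover have "Poly_Mapping.keys (word_row u) \<subseteq> J" using Cons by (auto simp: words_def)
  ultimately show ?case using keys_add by (fastforce simp: word_row_def)
qed (simp add: word_row_def)

text \<open>
  In an abelian group the letters of a word can be sorted, so its value splits into a part that
  depends only on the exponent sums and the value of its constants.
\<close>

lemma (in comm_group) word_value_eq_row:
  assumes \<sigma>: "\<sigma> \<in> hom (free_Abelian_group J) G" and u: "u \<in> words G J"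
  shows "word_value G (\<lambda>g. g) (\<lambda>x. \<sigma> (frag_of x)) u =
    \<sigma> (word_row u) \<otimes> word_value G (\<lambda>g. g) (\<lambda>_. \<one>) u"
  using u
proof (induction u)
  let ?F = "free_Abelian_group J"
  interpret F: comm_group ?F by (rule abelian_free_Abelian_group)
  interpret \<sigma>: group_hom ?F G \<sigma> by unfold_locales (rule \<sigma>)
  case Nil
  then show ?case using \<sigma>.hom_one by (simp add: word_row_def)
next
  let ?F = "free_Abelian_group J"
  interpret F: comm_group ?F by (rule abelian_free_Abelian_group)
  interpret \<sigma>: group_hom ?F G \<sigma> by unfold_locales (rule \<sigma>)
  case (Cons l u)
  have id: "(\<lambda>g. g) \<in> hom G G" by (simp add: hom_def)
  have l: "l \<in> letters G J" and u: "u \<in> words G J" using Cons.prems by (auto simp: words_def)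
  have v: "word_value G (\<lambda>g. g) (\<lambda>_. \<one>) u \<in> carrier G"
    by (rule word_value_closed[OF is_group is_group id _ u]) auto
  have L: "letter_row l \<in> carrier ?F"
    using l by (cases l) (auto simp: letters_def keys_minus)
  have U: "word_row u \<in> carrier ?F" using keys_word_row[OF u] by simp
  have row: "\<sigma> (word_row (l # u)) = \<sigma> (letter_row l) \<otimes> \<sigma> (word_row u)"
    using \<sigma>.hom_mult[OF L U] by (simp add: word_row_def)
  have "letter_value G (\<lambda>g. g) (\<lambda>x. \<sigma> (frag_of x)) l =
      \<sigma> (letter_row l) \<otimes> letter_value G (\<lambda>g. g) (\<lambda>_. \<one>) l"
  proof (cases l)
    case (Const g)
    then show ?thesis using l \<sigma>.hom_one by (auto simp: letters_def)
  next
    case (Var x e)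
    then have x: "frag_of x \<in> carrier ?F" using l by (auto simp: letters_def)
    then show ?thesis using Var \<sigma>.hom_inv[OF x] \<sigma>.hom_closed[OF x] by auto
  qed
  moreover have "letter_value G (\<lambda>g. g) (\<lambda>_. \<one>) l \<in> carrier G"
    by (rule letter_value_closed[OF is_group is_group id _ l]) auto
  ultimately show ?case
    using Cons.IH[OF u] v \<sigma>.hom_closed[OF L] \<sigma>.hom_closed[OF U] by (simp add: row m_ac)
qed

text \<open>
  The form in which independence modulo \<open>p\<close> is used: integer coefficients and divisibility in place
  of arithmetic in the residue ring.
\<close>

lemma p_nonsingular_iff:
  assumes p: "Factorial_Ring.prime p"
  shows "p_nonsingular p I J w \<longleftrightarrow>
    (\<forall>S c. finite S \<and> S \<subseteq> I \<and> (\<forall>j\<in>J. int p dvd (\<Sum>i\<in>S. c i * exponent_sum j (w i)))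
      \<longrightarrow> (\<forall>i\<in>S. int p dvd c i))"
proof -
  let ?R = "residue_ring (int p)"
  interpret residues_prime p ?R by unfold_locales (use p in auto)
  have comb: "(\<Oplus>\<^bsub>?R\<^esub>i\<in>S. c i \<otimes>\<^bsub>?R\<^esub> (exponent_sum j (w i) mod int p)) =
      (\<Sum>i\<in>S. c i * exponent_sum j (w i)) mod int p"
    if "finite S" for S j c
  proof -
    have "(\<Oplus>\<^bsub>?R\<^esub>i\<in>S. c i \<otimes>\<^bsub>?R\<^esub> (exponent_sum j (w i) mod int p)) =
        (\<Oplus>\<^bsub>?R\<^esub>i\<in>S. (c i * exponent_sum j (w i)) mod int p)"
      by (rule add.finprod_cong') (auto simp: res_mult_eq mod_mult_right_eq)
    also have "\<dots> = (\<Sum>i\<in>S. c i * exponent_sum j (w i)) mod int p"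
      by (rule sum_cong) fact
    finally show ?thesis .
  qed
  show ?thesis (is "?lhs = ?rhs")
  proof
    assume L: ?lhs
    show ?rhs
    proof (intro allI impI, elim conjE)
      fix S c
      assume S: "finite S" "S \<subseteq> I" and dvd: "\<forall>j\<in>J. int p dvd (\<Sum>i\<in>S. c i * exponent_sum j (w i))"
      have "(\<Sum>i\<in>S. (c i mod int p) * exponent_sum j (w i)) mod int p = 0" if "j \<in> J" for j
      proof -
        have "(\<Sum>i\<in>S. (c i mod int p) * exponent_sum j (w i)) mod int p =
            (\<Sum>i\<in>S. ((c i mod int p) * exponent_sum j (w i)) mod int p) mod int p"
          by (simp only: mod_sum_eq)
        also have "\<dots> = (\<Sum>i\<in>S. c i * exponent_sum j (w i)) mod int p"
          by (simp only: mod_mult_left_eq mod_sum_eq)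
        finally show ?thesis using dvd that by auto
      qed
      then have "\<forall>j\<in>J. (\<Oplus>\<^bsub>?R\<^esub>i\<in>S. (c i mod int p) \<otimes>\<^bsub>?R\<^esub> (exponent_sum j (w i) mod int p)) = \<zero>\<^bsub>?R\<^esub>"
        using S by (simp add: comb res_zero_eq)
      moreover have "(\<lambda>i. c i mod int p) \<in> S \<rightarrow> carrier ?R" by auto
      ultimately have "\<forall>i\<in>S. c i mod int p = \<zero>\<^bsub>?R\<^esub>"
        using S L[unfolded p_nonsingular_def lin_indep_family_def, rule_format,
            of S "\<lambda>i. c i mod int p"] by blast
      then show "\<forall>i\<in>S. int p dvd c i" by (auto simp: res_zero_eq)
    qed
  next
    assume R: ?rhs
    show ?lhs
      unfolding p_nonsingular_def lin_indep_family_def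
    proof (intro allI impI, elim conjE)
      fix S c
      assume S: "finite S" "S \<subseteq> I" and c: "c \<in> S \<rightarrow> carrier ?R"
        and zero: "\<forall>j\<in>J. (\<Oplus>\<^bsub>?R\<^esub>i\<in>S. c i \<otimes>\<^bsub>?R\<^esub> (exponent_sum j (w i) mod int p)) = \<zero>\<^bsub>?R\<^esub>"
      have "\<forall>j\<in>J. int p dvd (\<Sum>i\<in>S. c i * exponent_sum j (w i))"
        using zero S(1) by (simp add: comb res_zero_eq dvd_eq_mod_eq_0)
      then have dvd: "\<forall>i\<in>S. int p dvd c i" using R S by blast
      have "c i = 0" if "i \<in> S" for i
      proof -
        have "0 \<le> c i" "c i < int p" using c that by (auto simp: res_carrier_eq Pi_iff)
        then show ?thesis using dvd that by (metis dvd_eq_mod_eq_0 mod_pos_pos_trivial)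
      qed
      then show "\<forall>i\<in>S. c i = \<zero>\<^bsub>?R\<^esub>" by (simp add: res_zero_eq)
    qed
  qed
qed

lemma frag_extend_hom:
  assumes "\<And>i. i \<in> I \<Longrightarrow> Poly_Mapping.keys (r i) \<subseteq> J"
  shows "frag_extend r \<in> hom (free_Abelian_group I) (free_Abelian_group J)"
proof (rule homI)
  fix c assume "c \<in> carrier (free_Abelian_group I)"
  then have "Poly_Mapping.keys (frag_cmul (Poly_Mapping.lookup c i) (r i)) \<subseteq> J"
    if "i \<in> Poly_Mapping.keys c" for i
    using that assms keys_cmul[of _ "r i"] by fastforce
  then show "frag_extend r c \<in> carrier (free_Abelian_group J)"
    unfolding frag_extend_def by (intro sum_closed_free_Abelian_group) simp
qed (simp add: frag_extend_add)

text \<open>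
  The rows of a unimodular system are linearly independent and span a pure subgroup. If a
  combination of rows is divisible by a prime \<open>q\<close>, its coefficients vanish modulo \<open>q\<close>. If it is
  zero (\<open>q = 0\<close>), its coefficients are divisible by every prime, hence zero.
\<close>

lemma unimodular_pure:
  assumes u: "\<And>i. i \<in> I \<Longrightarrow> u i \<in> words G J"
    and w: "\<And>i. i \<in> I \<Longrightarrow> w i = word_class G J (u i)" and uni: "unimodular I J w"
    and q: "q = 0 \<or> Factorial_Ring.prime q"
    and c: "c \<in> carrier (free_Abelian_group I)"
    and eq: "frag_extend (\<lambda>i. word_row (u i)) c = f [^]\<^bsub>free_Abelian_group J\<^esub> (q::nat)"
  shows "\<exists>c'\<in>carrier (free_Abelian_group I). c = c' [^]\<^bsub>free_Abelian_group I\<^esub> q"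
proof -
  have key: "int p dvd Poly_Mapping.lookup c i" if p: "Factorial_Ring.prime p" and "p dvd q" for p i
  proof (cases "i \<in> Poly_Mapping.keys c")
    case True
    have "(\<Sum>i\<in>Poly_Mapping.keys c. Poly_Mapping.lookup c i * exponent_sum j (w i)) =
        (\<Sum>i\<in>Poly_Mapping.keys c. Poly_Mapping.lookup c i * word_exponent_sum j (u i))" for j
      using c w u by (intro sum.cong) (auto simp: exponent_sum_word_class)
    moreover have "(\<Sum>i\<in>Poly_Mapping.keys c. Poly_Mapping.lookup c i * word_exponent_sum j (u i)) =
        int q * Poly_Mapping.lookup f j" for j
      using arg_cong[OF eq, of "\<lambda>x. Poly_Mapping.lookup x j"]
      by (simp add: frag_extend_def lookup_sum lookup_word_row)
    ultimately have "\<forall>j\<in>J. int p dvd (\<Sum>i\<in>Poly_Mapping.keys c. Poly_Mapping.lookup c i * exponent_sum j (w i))"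
      using \<open>p dvd q\<close> by auto
    moreover have "p_nonsingular p I J w" using uni p by (simp add: unimodular_def)
    moreover have "finite (Poly_Mapping.keys c)" "Poly_Mapping.keys c \<subseteq> I" using c by auto
    ultimately have "\<forall>i\<in>Poly_Mapping.keys c. int p dvd Poly_Mapping.lookup c i"
      unfolding p_nonsingular_iff[OF p] by metis
    then show ?thesis using True by blast
  qed (simp add: in_keys_iff)
  have dvd: "int q dvd Poly_Mapping.lookup c i" for i
  proof (cases "q = 0")
    case True
    have "Poly_Mapping.lookup c i = 0"
    proof (rule ccontr)
      assume "Poly_Mapping.lookup c i \<noteq> 0"
      \<comment> \<open>A prime larger than a non-zero coefficient cannot divide it.\<close>
      moreover obtain p where p: "Factorial_Ring.prime p" "p > nat \<bar>Poly_Mapping.lookup c i\<bar>"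
        using bigger_prime by blast
      ultimately have "\<not> int p dvd Poly_Mapping.lookup c i"
        using dvd_imp_le_int[of "Poly_Mapping.lookup c i" "int p"] by linarith
      then show False using key[OF p(1)] True by simp
    qed
    then show ?thesis by simp
  next
    case False
    then show ?thesis using key q by auto
  qed
  define c' where "c' = Poly_Mapping.map (\<lambda>x. x div int q) c"
  have "Poly_Mapping.lookup c i = Poly_Mapping.lookup (frag_cmul (int q) c') i" for i
    using dvd[of i] by (simp add: c'_def Poly_Mapping.map.rep_eq when_def)
  then have "c = frag_cmul (int q) c'" by (rule poly_mapping_eqI)
  moreover have "Poly_Mapping.keys c' \<subseteq> I"
    using c by (auto simp: c'_def in_keys_iff Poly_Mapping.map.rep_eq when_def split: if_splits)
  ultimately show ?thesis by (intro bexI[of _ c']) auto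
qed

text \<open>
  A solution is a homomorphism on the free abelian group of variables with prescribed values on
  the rows, namely the inverses of the constant parts.
\<close>

lemma (in comm_group) unimodular_solvable_of_divisible_powers:
  assumes "N \<ge> 1" and "divisible_powers G N"
    and sys: "equation_system G I J w" and uni: "unimodular I J w"
  shows "solvable_in_itself G I J w"
proof -
  have id: "(\<lambda>g. g) \<in> hom G G" by (simp add: hom_def)
  have "\<forall>i\<in>I. \<exists>u. u \<in> words G J \<and> w i = word_class G J u"
    using sys by (auto simp: equation_system_def free_product_carrier)
  then obtain u where u: "\<And>i. i \<in> I \<Longrightarrow> u i \<in> words G J"
      "\<And>i. i \<in> I \<Longrightarrow> w i = word_class G J (u i)" by metis
  define const where "const i = word_value G (\<lambda>g. g) (\<lambda>_. \<one>) (u i)" for i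
  have const: "const i \<in> carrier G" if "i \<in> I" for i
    unfolding const_def by (rule word_value_closed[OF is_group is_group id _ u(1)[OF that]]) auto
  then obtain \<beta> where \<beta>: "\<beta> \<in> hom (free_Abelian_group I) G"
      "\<And>i. i \<in> I \<Longrightarrow> \<beta> (frag_of i) = inv (const i)"
    using free_Abelian_group_universal[of "\<lambda>i. inv (const i)" I] by blast
  define \<rho> where "\<rho> = frag_extend (\<lambda>i. word_row (u i))"
  have \<rho>: "\<rho> \<in> hom (free_Abelian_group I) (free_Abelian_group J)"
    unfolding \<rho>_def by (rule frag_extend_hom, rule keys_word_row, rule u(1))
  have "\<exists>\<sigma>\<in>hom (free_Abelian_group J) G. \<forall>c\<in>carrier (free_Abelian_group I). \<sigma> (\<rho> c) = \<beta> c"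
    by (rule extend_hom_of_divisible_powers[OF comm_group_axioms assms(1,2) abelian_free_Abelian_group \<rho> \<beta>(1)])
      (rule unimodular_pure[OF u uni], auto simp: \<rho>_def)
  then obtain \<sigma> where \<sigma>: "\<sigma> \<in> hom (free_Abelian_group J) G"
      "\<And>c. c \<in> carrier (free_Abelian_group I) \<Longrightarrow> \<sigma> (\<rho> c) = \<beta> c" by blast
  have "word_value G (\<lambda>g. g) (\<lambda>x. \<sigma> (frag_of x)) (u i) = \<one>" if i: "i \<in> I" for i
  proof -
    have "\<sigma> (word_row (u i)) = inv (const i)"
      using \<sigma>(2)[of "frag_of i"] \<beta>(2) i by (simp add: \<rho>_def)
    then show ?thesis
      using word_value_eq_row[OF \<sigma>(1) u(1)[OF i]] const[OF i] by (simp add: const_def)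
  qed
  moreover have "(\<lambda>x. \<sigma> (frag_of x)) \<in> J \<rightarrow> carrier G"
    using hom_in_carrier[OF \<sigma>(1)] by auto
  ultimately have "solvable_in_itself G I J (\<lambda>i. word_class G J (u i))"
    by (subst solvable_in_itself_iff_substitution[OF is_group u(1)])
      (auto intro!: bexI[of _ "\<lambda>x. \<sigma> (frag_of x)"])
  then show ?thesis using u(2) by (simp add: solvable_in_itself_def)
qed


section \<open>An unsolvable chain of equations\<close>

text \<open>
  The equations \<open>x\<^sub>k = b\<^sub>k x\<^sub>k\<^sub>+\<^sub>1\<^bsup>n\<^sub>k\<^esup>\<close> form a unimodular system whatever the \<open>n\<^sub>k\<close> are: the matrix of exponent
  sums is triangular with \<open>1\<close> on the diagonal. The injections embed this countable system into the
  given types of indices and variables.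
\<close>

lemma (in comm_group) chain_system_solvable:
  assumes inj: "inj (a :: nat \<Rightarrow> 'i)" "inj (y :: nat \<Rightarrow> 'j)"
    and all: "\<And>(I :: 'i set) (J :: 'j set) (w :: 'i \<Rightarrow> ('a, 'j) letter list set).
      equation_system G I J w \<Longrightarrow> unimodular I J w \<Longrightarrow> solvable_in_itself G I J w"
    and b: "\<And>k::nat. b k \<in> carrier G"
  shows "\<exists>x. \<forall>k. x k \<in> carrier G \<and> x k = b k \<otimes> x (Suc k) [^] (n k :: nat)"
proof -
  define eqn where "eqn k = Var (y k) True # replicate (n k) (Var (y (Suc k)) False) @ [Const (inv (b k))]" for k
  define u where "u i = eqn (inv_into UNIV a i)" for i
  have ua: "u (a k) = eqn k" for k using inj by (simp add: u_def)
  have eqn: "eqn k \<in> words G (range y)" for k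
    using b by (auto simp: eqn_def words_def letters_def)
  then have u: "u i \<in> words G (range y)" for i by (simp add: u_def)
  define w where "w i = word_class G (range y) (u i)" for i
  have "word_exponent_sum (y j) (eqn k) = (if j = k then 1 else 0) - (if j = Suc k then int (n k) else 0)" for j k
    using inj(2) by (auto simp: word_exponent_sum_def eqn_def sum_list_replicate inj_eq)
  then have expo: "exponent_sum (y j) (w (a k)) =
      (if j = k then 1 else 0) - (if j = Suc k then int (n k) else 0)" for j k
    using eqn by (simp add: w_def ua exponent_sum_word_class)
  have "p_nonsingular p (range a) (range y) w"
    if p: "Factorial_Ring.prime p" for p
  proof -
    have indep: "\<forall>i\<in>S. int p dvd c i"
      if S: "finite S" "S \<subseteq> range a"
        and dvd: "\<And>j. int p dvd (\<Sum>i\<in>S. c i * exponent_sum (y j) (w i))" for S and c :: "'i \<Rightarrow> int"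
    proof -
      \<comment> \<open>Column \<open>y k\<close> meets only the rows \<open>k\<close> and \<open>k - 1\<close>, so the coefficients vanish modulo \<open>p\<close> in turn.\<close>
      have "a k \<in> S \<longrightarrow> int p dvd c (a k)" for k
      proof (induction k rule: less_induct)
        case (less k)
        show ?case
        proof
          assume k: "a k \<in> S"
          have "(\<Sum>i\<in>S. c i * exponent_sum (y k) (w i)) =
              c (a k) * exponent_sum (y k) (w (a k)) + (\<Sum>i\<in>S - {a k}. c i * exponent_sum (y k) (w i))"
            using S k by (simp add: sum.remove)
          moreover have "int p dvd (\<Sum>i\<in>S - {a k}. c i * exponent_sum (y k) (w i))"
          proof (rule dvd_sum)
            fix i assume i: "i \<in> S - {a k}"
            then obtain l where l: "i = a l" "l \<noteq> k" using S by auto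
            show "int p dvd c i * exponent_sum (y k) (w i)"
            proof (cases "k = Suc l")
              case True
              then show ?thesis using less[of l] i l by auto
            next
              case False
              then show ?thesis using l by (simp add: expo)
            qed
          qed
          ultimately show "int p dvd c (a k)"
            using dvd[of k] by (simp add: expo dvd_add_left_iff)
        qed
      qed
      then show ?thesis using S by auto
    qed
    show ?thesis
      unfolding p_nonsingular_iff[OF p] by (intro allI impI, elim conjE, rule indep) auto
  qed
  then have "unimodular (range a) (range y) w"
    by (simp add: unimodular_def)
  moreover have "equation_system G (range a) (range y) w"
    using u by (auto simp: w_def equation_system_def free_product_carrier)
  ultimately have "solvable_in_itself G (range a) (range y) w"
    by (rule all[rotated])
  then obtain s where s: "s \<in> range y \<rightarrow> carrier G"
      "\<And>i. i \<in> range a \<Longrightarrow> word_value G (\<lambda>g. g) s (u i) = \<one>"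
    using solvable_in_itself_iff_substitution[where I="range a" and u=u and J="range y", OF is_group u]
    unfolding w_def by blast
  have sc: "s (y k) \<in> carrier G" for k using s(1) by auto
  have tail: "word_value G (\<lambda>g. g) s (replicate m (Var (y l) False) @ [Const (inv (b k))]) =
      inv (s (y l) [^] m) \<otimes> inv (b k)" for m k l
  proof (induction m)
    case 0
    then show ?case using b by simp
  next
    case (Suc m)
    then show ?case using sc b by (simp add: inv_mult_group m_assoc)
  qed
  have "s (y k) = b k \<otimes> s (y (Suc k)) [^] n k" for k
  proof -
    have "s (y k) \<otimes> (inv (s (y (Suc k)) [^] n k) \<otimes> inv (b k)) = \<one>"
      using s(2)[of "a k"] by (simp add: ua eqn_def tail)
    then have "s (y k) \<otimes> inv (b k \<otimes> s (y (Suc k)) [^] n k) = \<one>"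
      using b sc by (simp add: inv_mult_group)
    then show ?thesis
      using b sc by (metis inv_closed inv_equality inv_inv m_closed nat_pow_closed)
  qed
  with sc have "\<forall>k. s (y k) \<in> carrier G \<and> s (y k) = b k \<otimes> s (y (Suc k)) [^] n k"
    by (intro allI conjI)
  then show ?thesis by (rule exI[of _ "\<lambda>k. s (y k)"])
qed

text \<open>
  A chain of equations makes \<open>x\<^sub>0\<close> equal to \<open>s\<^sub>k x\<^sub>k\<^bsup>N\<^sub>k\<^esup>\<close>, where \<open>s\<^sub>k\<close> and \<open>N\<^sub>k\<close> depend on the first \<open>k\<close> constants and
  exponents only; thus \<open>x\<^sub>0\<close> is a limit of the \<open>s\<^sub>k\<close>. If no group of powers is divisible, then \<open>b\<^sub>k\<close> and
  \<open>n\<^sub>k\<close> can be chosen one after another so that step \<open>k\<close> rules out \<open>x\<^sub>0\<^bsup>k+1\<^esup> = 1\<close>. No order is left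
  for \<open>x\<^sub>0\<close>, which contradicts periodicity.
\<close>

lemma (in comm_group) divisible_powers_of_chains_solvable:
  assumes periodic: "periodic_group G"
    and chains: "\<And>b n. (\<And>k::nat. b k \<in> carrier G) \<Longrightarrow>
      \<exists>x. \<forall>k. x k \<in> carrier G \<and> x k = b k \<otimes> x (Suc k) [^] (n k :: nat)"
  shows "\<exists>N\<ge>1. divisible_powers G N"
proof (rule ccontr)
  assume not: "\<not> ?thesis"
  \<comment> \<open>The value \<open>(s b\<^sup>N)\<^sup>m\<close> can be kept out of the \<open>m N n\<close>-th powers: take \<open>n\<close> and \<open>g\<close> with \<open>g\<^bsup>m N\<^esup>\<close> not
    an \<open>m N n\<close>-th power. As these powers form a group, one of \<open>b = 1\<close> and \<open>b = g\<close> works.\<close>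
  have step: "\<exists>b n. b \<in> carrier G \<and> n \<ge> 1 \<and> (\<forall>h\<in>carrier G. (s \<otimes> b [^] N) [^] m \<noteq> h [^] (m * N * n))"
    if s: "s \<in> carrier G" and Nm: "N \<ge> 1" "m \<ge> 1" for s and N m :: nat
  proof -
    have "m * N \<ge> 1" using Nm by simp
    then obtain n g where ng: "n \<ge> 1" "g \<in> carrier G" "\<And>h. h \<in> carrier G \<Longrightarrow> h [^] (m * N * n) \<noteq> g [^] (m * N)"
      using not unfolding divisible_powers_def by blast
    show ?thesis
    proof (cases "\<exists>h\<in>carrier G. s [^] m = h [^] (m * N * n)")
      case False
      then show ?thesis using s ng(1) by (intro exI[of _ \<one>] exI[of _ n]) auto
    next
      case True
      then obtain h where h: "h \<in> carrier G" "s [^] m = h [^] (m * N * n)" by blast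
      have "(s \<otimes> g [^] N) [^] m \<noteq> h' [^] (m * N * n)" if h': "h' \<in> carrier G" for h'
      proof
        assume "(s \<otimes> g [^] N) [^] m = h' [^] (m * N * n)"
        then have "h [^] (m * N * n) \<otimes> g [^] (m * N) = h' [^] (m * N * n)"
          using s ng(2) h(2) by (simp add: nat_pow_distrib nat_pow_pow mult.commute)
        then have "g [^] (m * N) = inv (h [^] (m * N * n)) \<otimes> h' [^] (m * N * n)"
          using h(1) h' ng(2) inv_solve_left' by (metis nat_pow_closed)
        also have "\<dots> = (inv h \<otimes> h') [^] (m * N * n)"
          using h(1) h' by (simp add: nat_pow_distrib nat_pow_inv)
        finally show False using ng(3)[of "inv h \<otimes> h'"] h(1) h' by simp
      qed
      then show ?thesis using ng by blast
    qed
  qed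
  then obtain B \<nu> where B\<nu>: "\<And>s N m. s \<in> carrier G \<Longrightarrow> N \<ge> 1 \<Longrightarrow> m \<ge> 1 \<Longrightarrow>
      B s N m \<in> carrier G \<and> \<nu> s N m \<ge> (1::nat) \<and>
      (\<forall>h\<in>carrier G. (s \<otimes> B s N m [^] N) [^] m \<noteq> h [^] (m * N * \<nu> s N m))"
    by metis
  \<comment> \<open>The pair \<open>(s\<^sub>k, N\<^sub>k)\<close>; step \<open>k\<close> treats the exponent \<open>Suc k\<close>, so that every \<open>m \<ge> 1\<close> is treated.\<close>
  define st where "st = rec_nat (\<one>, 1) (\<lambda>k (s, N). (s \<otimes> B s N (Suc k) [^] N, N * \<nu> s N (Suc k)))"
  define s where "s k = fst (st k)" for k
  define N where "N k = snd (st k)" for k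
  define b where "b k = B (s k) (N k) (Suc k)" for k
  define n where "n k = \<nu> (s k) (N k) (Suc k)" for k
  have rec: "s 0 = \<one>" "N 0 = 1" "s (Suc k) = s k \<otimes> b k [^] N k" "N (Suc k) = N k * n k" for k
    by (simp_all add: s_def N_def b_def n_def st_def split: prod.split)
  have inv: "s k \<in> carrier G \<and> N k \<ge> 1" for k
  proof (induction k)
    case (Suc k)
    then show ?case using B\<nu>[of "s k" "N k" "Suc k"] by (simp add: rec b_def n_def)
  qed (simp add: rec)
  then have bn: "b k \<in> carrier G" "\<And>h. h \<in> carrier G \<Longrightarrow> s (Suc k) [^] Suc k \<noteq> h [^] (Suc k * N k * n k)" for k
    using B\<nu>[of "s k" "N k" "Suc k"] unfolding rec b_def n_def by auto
  obtain x where x: "\<And>k. x k \<in> carrier G" "\<And>k. x k = b k \<otimes> x (Suc k) [^] n k"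
    using chains[of b n] bn(1) by blast
  have x0: "x 0 = s k \<otimes> x k [^] N k" for k
  proof (induction k)
    case (Suc k)
    have "x k [^] N k = b k [^] N k \<otimes> x (Suc k) [^] N (Suc k)"
      using x(1) bn(1) by (subst x(2)) (simp add: nat_pow_distrib nat_pow_pow rec mult.commute)
    then show ?case using Suc inv[of k] bn(1)[of k] x(1) by (simp add: rec m_assoc)
  qed (use x(1) in \<open>simp add: rec\<close>)
  obtain m :: nat where m: "m \<ge> 1" "x 0 [^] m = \<one>"
    using periodic x(1) unfolding periodic_group_def by blast
  then obtain k where k: "m = Suc k" by (cases m) auto
  have "s (Suc k) [^] m \<otimes> x (Suc k) [^] (N (Suc k) * m) = \<one>"
    using m(2) x(1) inv[of "Suc k"] x0[of "Suc k"] by (simp add: nat_pow_distrib nat_pow_pow)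
  moreover have "N (Suc k) * m = m * N k * n k" by (simp add: rec mult_ac)
  ultimately have "s (Suc k) [^] m \<otimes> x (Suc k) [^] (m * N k * n k) = \<one>" by metis
  then have "s (Suc k) [^] m = inv (x (Suc k) [^] (m * N k * n k))"
    using x(1) inv[of "Suc k"] by (metis inv_equality nat_pow_closed)
  also have "\<dots> = (inv x (Suc k)) [^] (m * N k * n k)"
    using x(1) by (simp add: nat_pow_inv)
  finally show False using bn(2)[of "inv x (Suc k)" k] x(1) k by simp
qed


section \<open>The criterion\<close>

theorem theorem1:
  fixes A :: "('a, 'm) monoid_scheme" and C :: "'a set"
  assumes "comm_group A"
    and "periodic_group A"
    and "is_reduced_part A C"
    and "infinite (UNIV :: 'i set)"
    and "infinite (UNIV :: 'j set)"
  shows "(\<forall>(I :: 'i set) (J :: 'j set) (w :: 'i \<Rightarrow> ('a, 'j) letter list set).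
            equation_system A I J w \<and> unimodular I J w \<longrightarrow> solvable_in_itself A I J w)
         \<longleftrightarrow> bounded_period (A\<lparr>carrier := C\<rparr>)"
proof -
  interpret A: comm_group A by fact
  show ?thesis
    unfolding A.bounded_reduced_part_iff[OF assms(3)]
  proof
    assume all: "\<forall>(I :: 'i set) (J :: 'j set) (w :: 'i \<Rightarrow> ('a, 'j) letter list set).
      equation_system A I J w \<and> unimodular I J w \<longrightarrow> solvable_in_itself A I J w"
    obtain a :: "nat \<Rightarrow> 'i" and y :: "nat \<Rightarrow> 'j" where inj: "inj a" "inj y"
      using infinite_countable_subset[OF assms(4)] infinite_countable_subset[OF assms(5)] by blast
    show "\<exists>N\<ge>1. divisible_powers A N"
    proof (rule A.divisible_powers_of_chains_solvable[OF assms(2)])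
      fix b :: "nat \<Rightarrow> 'a" and n :: "nat \<Rightarrow> nat"
      assume b: "\<And>k. b k \<in> carrier A"
      show "\<exists>x. \<forall>k. x k \<in> carrier A \<and> x k = b k \<otimes>\<^bsub>A\<^esub> x (Suc k) [^]\<^bsub>A\<^esub> n k"
        by (rule A.chain_system_solvable[OF inj _ b]) (rule all[rule_format], rule conjI)
    qed
  next
    assume "\<exists>N\<ge>1. divisible_powers A N"
    then show "\<forall>(I :: 'i set) (J :: 'j set) (w :: 'i \<Rightarrow> ('a, 'j) letter list set).
      equation_system A I J w \<and> unimodular I J w \<longrightarrow> solvable_in_itself A I J w"
      by (auto intro: A.unimodular_solvable_of_divisible_powers)
  qed
qed

end
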